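(* Let $G$ be a finite extension of a countable group $H$. Let $G\curvearrowright X$ be a free continuous action on a compact metrizable space. Suppose that the restricted action $H\curvearrowright X$ is almost finite. Then the action $G\curvearrowright X$ is almost finite.
   Context: That $G$ is a finite extension of $H$ means that $G$ contains $H$ as a normal subgroup with finite quotient $G/H$. For finite subsets $K,F$ of a group $G$ put $\partial_K F=\{t\in G: Kt\cap F\neq\emptyset \text{ and } Kt\cap (G\setminus F)\neq\emptyset\}$. For $\delta>0$, $F$ is $(K,\delta)$-invariant if $|\partial_K F|\le\delta|F|$. Let $G\curvearrowright X$ be a free continuous action of a countable group on a compact metrizable space, equipped with a compatible metric. A tower is a pair $(S,V)$ where $S\subseteq G$ is finite (the shape) and $V\subseteq X$ (the base) are such that the sets $sV$ for $s\in S$ (the levels) are pairwise disjoint; it is open if $V$ is open. A castle is a finite collection $\{(S_i,V_i)\}_{i\in I}$ of towers such that the sets $S_iV_i$, $i\in I$, are pairwise disjoint; it is open if each of its towers is open. For $A,B\subseteq X$ write $A\prec B$ (with respect to the $G$-action) if for every closed set $C\subseteq A$ there are finitely many open sets $U_1,\dots,U_n$ which cover $C$ and elements $s_1,\dots,s_n\in G$ such that the sets $s_iU_i$, $i=1,\dots,n$, are pairwise disjoint and contained in $B$. The action $G\curvearrowright X$ is almost finite if for every $n\in\mathbb{N}$ ($n\geq 1$), finite set $K\subseteq G$, and $\delta>0$ there exist (i) an open castle $\{(S_i,V_i)\}_{i\in I}$ each of whose shapes is $(K,\delta)$-invariant and each of whose levels has diameter less than $\delta$, and (ii) sets $S_i'\subseteq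 S_i$ such that $|S_i'|\le|S_i|/n$ for every $i\in I$ and $X\setminus\bigsqcup_{i\in I}S_iV_i\prec\bigsqcup_{i\in I}S_i'V_i$. For the restricted action, all of these notions are taken with $H$ as the acting group. *)

theory Defs
  imports "HOL-Analysis.Analysis" "HOL-Algebra.Group_Action" "HOL-Algebra.Coset"
begin

text \<open>
  Throughout, \<open>G\<close> is a group in the sense of HOL-Algebra and an action is a homomorphism
  \<open>\<phi>\<close> from \<open>G\<close> to the bijections of \<open>X\<close> (locale \<open>group_action\<close>), so \<open>\<phi> s ` V\<close> is the
  translate \<open>sV\<close>.  The space \<open>X\<close> is a compact subset of a metric space, with the
  induced topology and metric; ``open'' and ``closed'' always mean relatively to \<open>X\<close>.
  The restriction of the action to a subgroup \<open>H\<close> is given by the group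
  \<open>G\<lparr>carrier := H\<rparr>\<close> together with the same map \<open>\<phi>\<close>.
\<close>

definition finite_extension :: "('g, 'm) monoid_scheme \<Rightarrow> 'g set \<Rightarrow> bool" where
  "finite_extension G H \<longleftrightarrow> H \<lhd> G \<and> finite (carrier (G Mod H))"

definition free_continuous_action ::
  "('g, 'm) monoid_scheme \<Rightarrow> 'x::metric_space set \<Rightarrow> ('g \<Rightarrow> 'x \<Rightarrow> 'x) \<Rightarrow> bool" where
  "free_continuous_action G X \<phi> \<longleftrightarrow>
     group_action G X \<phi> \<and>
     (\<forall>g\<in>carrier G. continuous_on X (\<phi> g)) \<and>
     (\<forall>g\<in>carrier G. \<forall>x\<in>X. \<phi> g x = x \<longrightarrow> g = \<one>\<^bsub>G\<^esub>)"

definition boundary :: "('g, 'm) monoid_scheme \<Rightarrow> 'g set \<Rightarrow> 'g set \<Rightarrow> 'g set" where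
  "boundary G K F =
     {t \<in> carrier G. (K #>\<^bsub>G\<^esub> t) \<inter> F \<noteq> {} \<and> (K #>\<^bsub>G\<^esub> t) \<inter> (carrier G - F) \<noteq> {}}"

definition invariant_set :: "('g, 'm) monoid_scheme \<Rightarrow> 'g set \<Rightarrow> real \<Rightarrow> 'g set \<Rightarrow> bool" where
  "invariant_set G K \<delta> F \<longleftrightarrow> real (card (boundary G K F)) \<le> \<delta> * real (card F)"

definition tower ::
  "('g, 'm) monoid_scheme \<Rightarrow> 'x set \<Rightarrow> ('g \<Rightarrow> 'x \<Rightarrow> 'x) \<Rightarrow> 'g set \<Rightarrow> 'x set \<Rightarrow> bool" where
  "tower G X \<phi> S V \<longleftrightarrow>
     finite S \<and> S \<subseteq> carrier G \<and> V \<subseteq> X \<and> disjoint_family_on (\<lambda>s. \<phi> s ` V) S"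

definition translates :: "('g \<Rightarrow> 'x \<Rightarrow> 'x) \<Rightarrow> 'g set \<Rightarrow> 'x set \<Rightarrow> 'x set" where
  "translates \<phi> S V = (\<Union>s\<in>S. \<phi> s ` V)"

definition castle ::
  "('g, 'm) monoid_scheme \<Rightarrow> 'x set \<Rightarrow> ('g \<Rightarrow> 'x \<Rightarrow> 'x) \<Rightarrow>
     'i set \<Rightarrow> ('i \<Rightarrow> 'g set) \<Rightarrow> ('i \<Rightarrow> 'x set) \<Rightarrow> bool" where
  "castle G X \<phi> I S V \<longleftrightarrow>
     finite I \<and> (\<forall>i\<in>I. tower G X \<phi> (S i) (V i)) \<and>
     disjoint_family_on (\<lambda>i. translates \<phi> (S i) (V i)) I"

definition open_castle ::
  "('g, 'm) monoid_scheme \<Rightarrow> 'x::metric_space set \<Rightarrow> ('g \<Rightarrow> 'x \<Rightarrow> 'x) \<Rightarrow>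
     'i set \<Rightarrow> ('i \<Rightarrow> 'g set) \<Rightarrow> ('i \<Rightarrow> 'x set) \<Rightarrow> bool" where
  "open_castle G X \<phi> I S V \<longleftrightarrow>
     castle G X \<phi> I S V \<and> (\<forall>i\<in>I. openin (top_of_set X) (V i))"

text \<open>The relation \<open>A \<prec> B\<close>.\<close>

definition subequivalent ::
  "('g, 'm) monoid_scheme \<Rightarrow> 'x::metric_space set \<Rightarrow> ('g \<Rightarrow> 'x \<Rightarrow> 'x) \<Rightarrow> 'x set \<Rightarrow> 'x set \<Rightarrow> bool" where
  "subequivalent G X \<phi> A B \<longleftrightarrow>
     (\<forall>C. closedin (top_of_set X) C \<and> C \<subseteq> A \<longrightarrow>
       (\<exists>(m::nat) U s.
          (\<forall>j<m. openin (top_of_set X) (U j) \<and> s j \<in> carrier G) \<and>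
          C \<subseteq> (\<Union>j<m. U j) \<and>
          disjoint_family_on (\<lambda>j. \<phi> (s j) ` U j) {..<m} \<and>
          (\<forall>j<m. \<phi> (s j) ` U j \<subseteq> B)))"

text \<open>Finite index sets are taken among the sets of natural numbers, without loss of generality.\<close>

definition almost_finite ::
  "('g, 'm) monoid_scheme \<Rightarrow> 'x::metric_space set \<Rightarrow> ('g \<Rightarrow> 'x \<Rightarrow> 'x) \<Rightarrow> bool" where
  "almost_finite G X \<phi> \<longleftrightarrow>
     (\<forall>(n::nat) K (\<delta>::real). n \<ge> 1 \<and> finite K \<and> K \<subseteq> carrier G \<and> \<delta> > 0 \<longrightarrow>
       (\<exists>(I::nat set) S V S'.
          open_castle G X \<phi> I S V \<and>
          (\<forall>i\<in>I. invariant_set G K \<delta> (S i)) \<and>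
          (\<forall>i\<in>I. \<forall>s\<in>S i. diameter (\<phi> s ` V i) < \<delta>) \<and>
          (\<forall>i\<in>I. S' i \<subseteq> S i \<and> real (card (S' i)) \<le> real (card (S i)) / real n) \<and>
          subequivalent G X \<phi>
            (X - (\<Union>i\<in>I. translates \<phi> (S i) (V i)))
            (\<Union>i\<in>I. translates \<phi> (S' i) (V i))))"

end

theory Submission
  imports Defs
begin

text \<open>
  Let \<open>T\<close> represent the finitely many cosets of \<open>H\<close> in \<open>G\<close>.  If \<open>S \<subseteq> H\<close> is a sufficiently invariant shape, then
  so is \<open>TS \<subseteq> G\<close> (\<open>invariant_set_transversal_mult\<close>), so one would like to turn an \<open>H\<close>-castle with towers
  \<open>(S, V)\<close> into a \<open>G\<close>-castle with towers \<open>(TS, V)\<close>.  But the \<open>T\<close>-translates of the \<open>H\<close>-castle overlap: each of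
  them nearly covers \<open>X\<close>.  One has to thin out the bases so that, on each orbit of \<open>G\<close>, the tiles of only one of the
  cosets of \<open>H\<close> are kept at each place.

  Exactly this is achieved by an open set \<open>Y\<close> whose translates \<open>tY\<close>, \<open>t \<in> T\<close>, are disjoint and nearly cover
  \<open>X\<close>, and which is nearly invariant under a prescribed finite subset of \<open>H\<close>
  (\<open>approximate_fundamental_domain\<close>).  To find it, colour the points of \<open>X\<close> by means of a castle with much larger
  shapes so that the colour is constant on tiles, but differs between tiles in different cosets
  that are close to each other (\<open>coloured_regions\<close>); freeness and bases of very small diameter make this
  possible.  Then let \<open>Y\<close> consist of the points whose coset has the least colour.

  All exceptional sets are measured by their upper density along invariant subsets of \<open>H\<close> (\<open>density_le\<close>),
  which bounds their measure for every \<open>H\<close>-invariant probability measure.  This notion is invariant under \<open>G\<close> by normality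
  (\<open>density_le_translate\<close>), the remainders of castles of an almost finite action have small density
  (\<open>castle_with_small_remainder\<close>), and conversely a closed set can be moved into an open set of larger density
  (\<open>comparison\<close>).  The last fact moves the remainder of the \<open>G\<close>-castle, by elements of \<open>H\<close>, into a
  small proportion of its levels.
\<close>

section \<open>Invariant finite sets\<close>

lemma boundary_iff:
  "t \<in> boundary G K F \<longleftrightarrow> t \<in> carrier G \<and> (\<exists>k\<in>K. k \<otimes>\<^bsub>G\<^esub> t \<in> F)
     \<and> (\<exists>k\<in>K. k \<otimes>\<^bsub>G\<^esub> t \<in> carrier G - F)"
  by (auto simp: boundary_def r_coset_def)

lemma boundary_mono: "K \<subseteq> K' \<Longrightarrow> boundary G K F \<subseteq> boundary G K' F"
  unfolding boundary_def r_coset_def by blast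

lemma (in group) finite_boundary:
  assumes "finite K" "finite F" "K \<subseteq> carrier G"
  shows "finite (boundary G K F)"
proof (rule finite_subset)
  show "boundary G K F \<subseteq> (\<lambda>(k, f). inv k \<otimes> f) ` (K \<times> F)"
  proof
    fix t assume "t \<in> boundary G K F"
    then obtain k where "t \<in> carrier G" "k \<in> K" "k \<otimes> t \<in> F" by (auto simp: boundary_iff)
    moreover have "t = inv k \<otimes> (k \<otimes> t)"
      using calculation assms by (simp add: inv_solve_left' subset_iff m_assoc[symmetric])
    ultimately show "t \<in> (\<lambda>(k, f). inv k \<otimes> f) ` (K \<times> F)" by (force intro!: image_eqI)
  qed
qed (use assms in simp)

lemma (in group) invariant_set_mono:
  assumes "finite K'" "finite F" "K' \<subseteq> carrier G" "K \<subseteq> K'" "\<delta>' \<le> \<delta>" "invariant_set G K' \<delta>' F"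
  shows "invariant_set G K \<delta> F"
proof -
  have "card (boundary G K F) \<le> card (boundary G K' F)"
    by (intro card_mono finite_boundary boundary_mono assms)
  moreover have "\<delta>' * card F \<le> \<delta> * real (card F)" using assms by (intro mult_right_mono) auto
  ultimately show ?thesis
    using assms(6) unfolding invariant_set_def by (meson of_nat_mono order_trans)
qed

text \<open>Invariance counts the \<open>t\<close> in the whole group near the boundary; with \<open>\<one> \<in> E\<close> the elements of
\<open>F\<close> that some \<open>e \<in> E\<close> pushes out of \<open>F\<close> are among them.\<close>

lemma (in group) card_escaping_le:
  fixes \<eta> :: real
  assumes "finite E" "finite F" "E \<subseteq> carrier G" "F \<subseteq> carrier G" "\<one> \<in> E" "invariant_set G E \<eta> F"
  shows "real (card {f\<in>F. \<exists>e\<in>E. e \<otimes> f \<notin> F}) \<le> \<eta> * real (card F)"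
proof -
  have "{f\<in>F. \<exists>e\<in>E. e \<otimes> f \<notin> F} \<subseteq> boundary G E F"
  proof
    fix f assume "f \<in> {f\<in>F. \<exists>e\<in>E. e \<otimes> f \<notin> F}"
    then obtain e where f: "f \<in> F" "e \<in> E" "e \<otimes> f \<notin> F" by blast
    then have c: "e \<in> carrier G" "f \<in> carrier G" using assms by auto
    then have "e \<otimes> f \<in> carrier G - F" "\<one> \<otimes> f \<in> F" using f by auto
    then show "f \<in> boundary G E F" unfolding boundary_iff using c f assms(5) by blast
  qed
  then have "card {f\<in>F. \<exists>e\<in>E. e \<otimes> f \<notin> F} \<le> card (boundary G E F)"
    by (intro card_mono finite_boundary assms)
  then show ?thesis
    using assms(6) unfolding invariant_set_def by (meson of_nat_mono order_trans)
qed

section \<open>Upper density along invariant sets\<close>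

locale set_action = group G + group_action G X \<phi>
  for G (structure) and X :: "'x set" and \<phi>
begin

lemma act_closed [simp, intro]: "g \<in> carrier G \<Longrightarrow> x \<in> X \<Longrightarrow> \<phi> g x \<in> X"
  using element_image by blast

lemma act_mult: "g \<in> carrier G \<Longrightarrow> h \<in> carrier G \<Longrightarrow> x \<in> X \<Longrightarrow> \<phi> (g \<otimes> h) x = \<phi> g (\<phi> h x)"
  by (simp add: composition_rule)

lemma act_one [simp]: "x \<in> X \<Longrightarrow> \<phi> \<one> x = x"
  using id_eq_one by (metis restrict_apply')

lemma act_inv [simp]:
  assumes "g \<in> carrier G" "x \<in> X"
  shows "\<phi> (inv g) (\<phi> g x) = x" "\<phi> g (\<phi> (inv g) x) = x"
  using assms by (simp_all flip: act_mult)

lemma mem_translate_iff: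
  assumes "g \<in> carrier G" "x \<in> X" "V \<subseteq> X"
  shows "x \<in> \<phi> g ` V \<longleftrightarrow> \<phi> (inv g) x \<in> V"
proof
  assume "\<phi> (inv g) x \<in> V"
  then have "\<phi> g (\<phi> (inv g) x) \<in> \<phi> g ` V" by (rule imageI)
  then show "x \<in> \<phi> g ` V" using assms by simp
qed (use assms in auto)

lemma translate_subset: "g \<in> carrier G \<Longrightarrow> V \<subseteq> X \<Longrightarrow> \<phi> g ` V \<subseteq> X"
  by auto

definition visits :: "'a set \<Rightarrow> 'x set \<Rightarrow> 'x \<Rightarrow> nat" where
  "visits F A x = card {f\<in>F. \<phi> f x \<in> A}"

text \<open>\<open>density_le A a\<close> says that the upper Banach density of \<open>A\<close> is at most \<open>a\<close>: along all sufficiently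
invariant finite sets, uniformly in the starting point, an orbit spends at most the proportion \<open>a\<close> of its
time in \<open>A\<close>.  It replaces the bound \<open>\<mu>(A) \<le> a\<close> for all invariant probability measures \<open>\<mu>\<close>.  Being
sufficiently invariant is expressed by a pair \<open>(E, \<eta>)\<close>; such pairs are directed, which makes finite unions
and finitely many simultaneous conditions harmless.\<close>

definition density_le :: "'x set \<Rightarrow> real \<Rightarrow> bool" where
  "density_le A a \<longleftrightarrow> (\<exists>E \<eta>. finite E \<and> E \<subseteq> carrier G \<and> \<eta> > 0 \<and>
     (\<forall>F x. finite F \<and> F \<subseteq> carrier G \<and> invariant_set G E \<eta> F \<and> x \<in> X
        \<longrightarrow> real (visits F A x) \<le> a * real (card F)))"

lemma density_leI:
  fixes a \<eta> :: real
  assumes "finite E" "E \<subseteq> carrier G" "\<eta> > 0"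
    "\<And>F x. finite F \<Longrightarrow> F \<subseteq> carrier G \<Longrightarrow> invariant_set G E \<eta> F \<Longrightarrow> x \<in> X
        \<Longrightarrow> real (visits F A x) \<le> a * real (card F)"
  shows "density_le A a"
  unfolding density_le_def
  by (rule exI[of _ E], rule exI[of _ \<eta>]) (use assms in simp)

lemma density_leE:
  fixes a :: real
  assumes "density_le A a"
  obtains E and \<eta> :: real where "finite E" "E \<subseteq> carrier G" "\<eta> > 0"
    "\<And>F x. finite F \<Longrightarrow> F \<subseteq> carrier G \<Longrightarrow> invariant_set G E \<eta> F \<Longrightarrow> x \<in> X
        \<Longrightarrow> real (visits F A x) \<le> a * real (card F)"
proof -
  from assms obtain E \<eta> where *: "finite E \<and> E \<subseteq> carrier G \<and> \<eta> > 0 \<and>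
     (\<forall>F x. finite F \<and> F \<subseteq> carrier G \<and> invariant_set G E \<eta> F \<and> x \<in> X
        \<longrightarrow> real (visits F A x) \<le> a * real (card F))"
    unfolding density_le_def by (elim exE)
  show ?thesis by (rule that[of E \<eta>]) (use * in simp_all)
qed

lemma visits_mono: "finite F \<Longrightarrow> x \<in> X \<Longrightarrow> F \<subseteq> carrier G \<Longrightarrow> A \<inter> X \<subseteq> B \<Longrightarrow> visits F A x \<le> visits F B x"
  unfolding visits_def by (intro card_mono) auto

lemma density_le_mono:
  assumes "density_le B b" "A \<inter> X \<subseteq> B" "b \<le> a"
  shows "density_le A a"
proof -
  obtain E and \<eta> :: real where E: "finite E" "E \<subseteq> carrier G" "\<eta> > 0"
    and *: "\<And>F x. finite F \<Longrightarrow> F \<subseteq> carrier G \<Longrightarrow> invariant_set G E \<eta> F \<Longrightarrow> x \<in> X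
        \<Longrightarrow> real (visits F B x) \<le> b * real (card F)"
    by (rule density_leE[OF assms(1)]) (rule that)
  show ?thesis
  proof (rule density_leI[OF E])
    fix F x assume F: "finite F" "F \<subseteq> carrier G" "invariant_set G E \<eta> F" "x \<in> X"
    have "b * real (card F) \<le> a * real (card F)" using assms by (intro mult_right_mono) auto
    then show "real (visits F A x) \<le> a * real (card F)"
      using *[OF F] visits_mono[OF F(1,4,2) assms(2)] by linarith
  qed
qed

lemma density_le_empty: "0 \<le> a \<Longrightarrow> density_le {} a"
  by (rule density_leI[of "{}" 1]) (auto simp: visits_def)

lemma density_le_Un:
  assumes "density_le A a" "density_le B b"
  shows "density_le (A \<union> B) (a + b)"
proof -
  obtain E and \<eta> :: real where E: "finite E" "E \<subseteq> carrier G" "\<eta> > 0"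
    and 1: "\<And>F x. finite F \<Longrightarrow> F \<subseteq> carrier G \<Longrightarrow> invariant_set G E \<eta> F \<Longrightarrow> x \<in> X
        \<Longrightarrow> real (visits F A x) \<le> a * real (card F)"
    by (rule density_leE[OF assms(1)]) (rule that)
  obtain E' and \<eta>' :: real where E': "finite E'" "E' \<subseteq> carrier G" "\<eta>' > 0"
    and 2: "\<And>F x. finite F \<Longrightarrow> F \<subseteq> carrier G \<Longrightarrow> invariant_set G E' \<eta>' F \<Longrightarrow> x \<in> X
        \<Longrightarrow> real (visits F B x) \<le> b * real (card F)"
    by (rule density_leE[OF assms(2)]) (rule that)
  show ?thesis
  proof (rule density_leI[of "E \<union> E'" "min \<eta> \<eta>'"])
    fix F x assume F: "finite F" "F \<subseteq> carrier G" "invariant_set G (E \<union> E') (min \<eta> \<eta>') F" "x \<in> X"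
    have i: "invariant_set G E \<eta> F" "invariant_set G E' \<eta>' F"
      by (rule invariant_set_mono[OF _ _ _ _ _ F(3)]; use E E' F in auto)+
    have "{f\<in>F. \<phi> f x \<in> A \<union> B} = {f\<in>F. \<phi> f x \<in> A} \<union> {f\<in>F. \<phi> f x \<in> B}" by auto
    then have "visits F (A \<union> B) x \<le> visits F A x + visits F B x"
      unfolding visits_def by (simp add: card_Un_le)
    then show "real (visits F (A \<union> B) x) \<le> (a + b) * real (card F)"
      using 1[OF F(1,2) i(1) F(4)] 2[OF F(1,2) i(2) F(4)] by (simp add: distrib_right)
  qed (use E E' in auto)
qed

lemma density_le_UN:
  assumes "finite J" "\<And>j. j \<in> J \<Longrightarrow> density_le (A j) (a j)"
  shows "density_le (\<Union>j\<in>J. A j) (\<Sum>j\<in>J. a j)"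
  using assms
proof (induction rule: finite_induct)
  case empty then show ?case by (simp add: density_le_empty)
next
  case (insert j J) then show ?case by (simp add: density_le_Un)
qed

text \<open>One finite set \<open>F\<^sub>0\<close> suffices to bound a density: if \<open>F\<close> is nearly invariant under \<open>F\<^sub>0\<close>, counting in
two ways the pairs in \<open>F\<^sub>0 \<times> F\<close> whose product moves \<open>x\<close> into \<open>A\<close> compares the visits along \<open>F\<close> with
those along the translates of \<open>F\<^sub>0\<close>.\<close>

lemma density_leI_single:
  fixes a \<eta> :: real
  assumes F0: "finite F0" "F0 \<noteq> {}" "F0 \<subseteq> carrier G" and "\<eta> > 0"
    and bound: "\<And>x. x \<in> X \<Longrightarrow> real (visits F0 A x) \<le> a * real (card F0)"
  shows "density_le A (a + \<eta>)"
proof (rule density_leI[of "insert \<one> (m_inv G ` F0)" \<eta>])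
  fix F x assume F: "finite F" "F \<subseteq> carrier G" "invariant_set G (insert \<one> (m_inv G ` F0)) \<eta> F" "x \<in> X"
  define P where "P = {(g, f). g \<in> F0 \<and> f \<in> F \<and> \<phi> (g \<otimes> f) x \<in> A}"
  have P1: "P = (SIGMA g:F0. {f\<in>F. \<phi> (g \<otimes> f) x \<in> A})" by (auto simp: P_def)
  have P2: "prod.swap ` P = (SIGMA f:F. {g\<in>F0. \<phi> g (\<phi> f x) \<in> A})"
  proof -
    have "\<phi> g (\<phi> f x) = \<phi> (g \<otimes> f) x" if "g \<in> F0" "f \<in> F" for f g
      using that F0 F act_mult by (metis subsetD)
    then show ?thesis by (auto simp: P_def image_iff)
  qed
  have "card P = card (prod.swap ` P)" by (simp add: card_image)
  also have "\<dots> = (\<Sum>f\<in>F. visits F0 A (\<phi> f x))"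
    unfolding P2 using F F0 by (subst card_SigmaI) (auto simp: visits_def)
  finally have "real (card P) = (\<Sum>f\<in>F. real (visits F0 A (\<phi> f x)))" by simp
  also have "\<dots> \<le> (\<Sum>f\<in>F. a * real (card F0))" using F by (intro sum_mono bound) auto
  finally have upper: "real (card P) \<le> real (card F) * (a * real (card F0))" by simp
  have "real (visits F A x) - \<eta> * real (card F) \<le> card {f\<in>F. \<phi> (g \<otimes> f) x \<in> A}" if g: "g \<in> F0" for g
  proof -
    let ?esc = "{f\<in>F. \<exists>e\<in>insert \<one> (m_inv G ` F0). e \<otimes> f \<notin> F}"
    have "real (card ?esc) \<le> \<eta> * real (card F)"
      by (rule card_escaping_le) (use F F0 in auto)
    moreover have "visits F A x \<le> card (?esc \<union> (\<lambda>f. g \<otimes> f) ` {f\<in>F. \<phi> (g \<otimes> f) x \<in> A})"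
      unfolding visits_def
    proof (intro card_mono subsetI)
      fix f assume "f \<in> {f\<in>F. \<phi> f x \<in> A}"
      then have f: "f \<in> F" "f \<in> carrier G" "\<phi> f x \<in> A" using F by auto
      have gc: "g \<in> carrier G" using g F0 by auto
      then have *: "g \<otimes> (inv g \<otimes> f) = f" using f by (simp add: m_assoc[symmetric])
      show "f \<in> ?esc \<union> (\<lambda>f. g \<otimes> f) ` {f\<in>F. \<phi> (g \<otimes> f) x \<in> A}"
      proof (cases "inv g \<otimes> f \<in> F")
        case True
        then have "inv g \<otimes> f \<in> {f\<in>F. \<phi> (g \<otimes> f) x \<in> A}" using f * by simp
        then have "g \<otimes> (inv g \<otimes> f) \<in> (\<lambda>f. g \<otimes> f) ` {f\<in>F. \<phi> (g \<otimes> f) x \<in> A}"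
          by (rule imageI)
        then show ?thesis unfolding * by (rule UnI2)
      qed (use f g in auto)
    qed (use F in auto)
    moreover have "\<dots> \<le> card ?esc + card {f\<in>F. \<phi> (g \<otimes> f) x \<in> A}"
      by (rule order_trans[OF card_Un_le]) (use F in \<open>simp add: card_image_le\<close>)
    ultimately show ?thesis by linarith
  qed
  then have "(\<Sum>g\<in>F0. real (visits F A x) - \<eta> * real (card F)) \<le> (\<Sum>g\<in>F0. real (card {f\<in>F. \<phi> (g \<otimes> f) x \<in> A}))"
    by (rule sum_mono)
  also have "\<dots> = card P" unfolding P1 using F F0 by (subst card_SigmaI) auto
  finally have "real (card F0) * (real (visits F A x) - \<eta> * real (card F)) \<le> real (card F0) * (a * real (card F))"
    using upper by (simp add: mult_ac)
  moreover have "real (card F0) > 0" using F0 by (simp add: card_gt_0_iff)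
  ultimately have "real (visits F A x) - \<eta> * real (card F) \<le> a * real (card F)"
    by (simp only: mult_le_cancel_left_pos)
  then show "real (visits F A x) \<le> (a + \<eta>) * real (card F)" unfolding distrib_right by linarith
qed (use F0 \<open>\<eta> > 0\<close> in auto)

text \<open>A set that can be cut into pieces and moved disjointly into \<open>B\<close> is no denser than \<open>B\<close>, because the moving
elements act on visiting times by an injection, up to the few times near the boundary of \<open>F\<close>.\<close>

lemma density_le_moved_into:
  fixes b \<eta> :: real
  assumes J: "finite J" and s: "\<And>j. j \<in> J \<Longrightarrow> s j \<in> carrier G" and U: "\<And>j. j \<in> J \<Longrightarrow> U j \<subseteq> X"
    and disj: "disjoint_family_on (\<lambda>j. \<phi> (s j) ` U j) J" and sub: "\<And>j. j \<in> J \<Longrightarrow> \<phi> (s j) ` U j \<subseteq> B"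
    and R: "R \<subseteq> (\<Union>j\<in>J. U j)" and B: "density_le B b" and \<eta>: "\<eta> > 0"
  shows "density_le R (b + \<eta>)"
proof -
  obtain E and \<eta>' :: real where E: "finite E" "E \<subseteq> carrier G" "\<eta>' > 0"
    and b: "\<And>F x. finite F \<Longrightarrow> F \<subseteq> carrier G \<Longrightarrow> invariant_set G E \<eta>' F \<Longrightarrow> x \<in> X
        \<Longrightarrow> real (visits F B x) \<le> b * real (card F)"
    by (rule density_leE[OF B]) (rule that)
  let ?E = "insert \<one> (s ` J)"
  show ?thesis
  proof (rule density_leI[of "E \<union> ?E" "min \<eta> \<eta>'"])
    fix F x assume F: "finite F" "F \<subseteq> carrier G" "invariant_set G (E \<union> ?E) (min \<eta> \<eta>') F" "x \<in> X"
    have i: "invariant_set G E \<eta>' F" "invariant_set G ?E \<eta> F"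
      by (rule invariant_set_mono[OF _ _ _ _ _ F(3)]; use E J s F in auto)+
    let ?esc = "{f\<in>F. \<exists>e\<in>?E. e \<otimes> f \<notin> F}"
    have esc: "real (card ?esc) \<le> \<eta> * real (card F)"
      by (rule card_escaping_le) (use F J s i in auto)
    let ?N = "{f\<in>F. \<phi> f x \<in> R} - ?esc"
    define j where "j f = (SOME j. j \<in> J \<and> \<phi> f x \<in> U j)" for f
    have j: "j f \<in> J \<and> \<phi> f x \<in> U (j f)" if "f \<in> ?N" for f
    proof -
      have "\<exists>j. j \<in> J \<and> \<phi> f x \<in> U j" using that R by blast
      then show ?thesis unfolding j_def by (rule someI_ex)
    qed
    have fc: "f \<in> carrier G" if "f \<in> ?N" for f using that F by auto
    have mv: "\<phi> (s (j f) \<otimes> f) x = \<phi> (s (j f)) (\<phi> f x)" if "f \<in> ?N" for f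
      using fc[OF that] j[OF that] s F(4) by (simp add: act_mult)
    have "inj_on (\<lambda>f. s (j f) \<otimes> f) ?N"
    proof (rule inj_onI)
      fix f g assume f: "f \<in> ?N" and g: "g \<in> ?N" and eq: "s (j f) \<otimes> f = s (j g) \<otimes> g"
      have "\<phi> (s (j f)) (\<phi> f x) = \<phi> (s (j g)) (\<phi> g x)" using mv[OF f] mv[OF g] eq by simp
      then have "j f = j g"
        using disj j[OF f] j[OF g] unfolding disjoint_family_on_def by blast
      then show "f = g" using eq fc[OF f] fc[OF g] s j[OF g] by simp
    qed
    then have "card ?N = card ((\<lambda>f. s (j f) \<otimes> f) ` ?N)" by (simp add: card_image)
    also have "\<dots> \<le> visits F B x"
      unfolding visits_def
    proof (intro card_mono subsetI)
      fix h assume "h \<in> (\<lambda>f. s (j f) \<otimes> f) ` ?N"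
      then obtain f where f: "f \<in> ?N" "h = s (j f) \<otimes> f" by blast
      have "\<phi> h x \<in> B" using f mv[OF f(1)] sub j[OF f(1)] by blast
      moreover have "h \<in> F" using f j[OF f(1)] by auto
      ultimately show "h \<in> {f\<in>F. \<phi> f x \<in> B}" by simp
    qed (use F in auto)
    finally have "real (card ?N) \<le> b * real (card F)" using b[OF F(1,2) i(1) F(4)] by linarith
    moreover have "visits F R x \<le> card (?N \<union> ?esc)"
      unfolding visits_def by (rule card_mono) (use F in auto)
    ultimately show "real (visits F R x) \<le> (b + \<eta>) * real (card F)"
      using esc card_Un_le[of ?N ?esc] by (simp add: distrib_right)
  qed (use E J s \<eta> in auto)
qed

lemma castle_levels_unique:
  assumes "castle G X \<phi> I S V"
    and "i \<in> I" "i' \<in> I" "s \<in> S i" "s' \<in> S i'" "y \<in> \<phi> s ` V i" "y \<in> \<phi> s' ` V i'"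
  shows "i = i' \<and> s = s'"
proof -
  have "i = i'"
    using assms unfolding castle_def disjoint_family_on_def translates_def by blast
  moreover have "s = s'"
    using assms calculation unfolding castle_def tower_def disjoint_family_on_def by blast
  ultimately show ?thesis by simp
qed

text \<open>The visiting times of an orbit to a castle are partitioned into tiles \<open>S i \<otimes> b\<close>, one for every time \<open>b\<close> at
which the orbit is in a base \<open>V i\<close>.  Each tile contained in \<open>F\<close> contributes at most the proportion \<open>c\<close> of its
elements, and the remaining visiting times lie near the boundary of \<open>F\<close>.\<close>

lemma density_le_subtowers:
  fixes I :: "'i set" and c \<eta> :: real
  assumes castle: "castle G X \<phi> I S V"
    and S': "\<And>i. i \<in> I \<Longrightarrow> S' i \<subseteq> S i" "\<And>i. i \<in> I \<Longrightarrow> real (card (S' i)) \<le> c * real (card (S i))"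
    and \<eta>: "\<eta> > 0" and c: "c \<ge> 0"
  shows "density_le (\<Union>i\<in>I. translates \<phi> (S' i) (V i)) (c + \<eta>)"
proof -
  have I: "finite I" and tow: "\<And>i. i \<in> I \<Longrightarrow> finite (S i) \<and> S i \<subseteq> carrier G \<and> V i \<subseteq> X"
    using castle by (auto simp: castle_def tower_def)
  have unique: "i = i' \<and> s = s'"
    if "i \<in> I" "i' \<in> I" "s \<in> S i" "s' \<in> S i'" "y \<in> \<phi> s ` V i" "y \<in> \<phi> s' ` V i'" for i i' s s' y
    by (rule castle_levels_unique[OF castle that])
  define E where "E = insert \<one> (\<Union>i\<in>I. (\<lambda>(s, s'). s \<otimes> inv s') ` (S i \<times> S i))"
  have E: "finite E" "E \<subseteq> carrier G" using I tow unfolding E_def by auto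
  show ?thesis
  proof (rule density_leI[of E \<eta>])
    fix F x assume F: "finite F" "F \<subseteq> carrier G" "invariant_set G E \<eta> F" "x \<in> X"
    let ?esc = "{f\<in>F. \<exists>e\<in>E. e \<otimes> f \<notin> F}"
    have esc: "real (card ?esc) \<le> \<eta> * real (card F)"
      by (rule card_escaping_le) (use F E in \<open>auto simp: E_def\<close>)
    \<comment> \<open>A pair \<open>(i, b)\<close> stands for the tile \<open>S i \<otimes> b\<close>. Empty shapes are left out, since they
      would admit infinitely many \<open>b\<close>.\<close>
    define tiles where "tiles = (SIGMA i:{i\<in>I. S i \<noteq> {}}. {b\<in>carrier G. \<phi> b x \<in> V i \<and> (\<forall>s\<in>S i. s \<otimes> b \<in> F)})"
    have cell: "\<phi> (s \<otimes> b) x \<in> \<phi> s ` V i"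
      if "(i, b) \<in> tiles" "s \<in> S i" for i b s
      using that tow F(4) unfolding tiles_def by (auto simp: act_mult subset_iff)
    have inj: "i = i' \<and> b = b'" if "(i, b) \<in> tiles" "(i', b') \<in> tiles" "s \<in> S i" "s' \<in> S i'"
      "s \<otimes> b = s' \<otimes> b'" for i i' b b' s s'
    proof -
      have "i = i' \<and> s = s'"
        using unique[of i i' s s' "\<phi> (s \<otimes> b) x"] cell[OF that(1,3)] cell[OF that(2,4)] that
        unfolding tiles_def by auto
      then show ?thesis using that tow unfolding tiles_def by (auto simp: subset_iff)
    qed
    define P where "P W = (SIGMA t:tiles. W (fst t))" for W :: "'i \<Rightarrow> 'a set"
    define pt where "pt = (\<lambda>((i::'i, b), s). s \<otimes> b)"
    have inj_pt: "inj_on pt (P S)"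
    proof (rule inj_onI)
      fix p q assume pq: "p \<in> P S" "q \<in> P S" "pt p = pt q"
      obtain i b s where p: "p = ((i, b), s)" by (cases p) auto
      obtain i' b' s' where q: "q = ((i', b'), s')" by (cases q) auto
      have "(i, b) \<in> tiles" "(i', b') \<in> tiles" "s \<in> S i" "s' \<in> S i'" "s \<otimes> b = s' \<otimes> b'"
        using pq unfolding p q P_def pt_def by simp_all
      moreover then have "s \<in> carrier G" "s' \<in> carrier G" "b \<in> carrier G"
        using tow unfolding tiles_def by auto
      ultimately show "p = q"
        using inj[of i b i' b' s s'] p q by auto
    qed
    have sub: "pt ` P S \<subseteq> F" by (auto simp: P_def pt_def tiles_def)
    then have fin: "finite (P S)" using inj_pt F(1) inj_on_finite by metis
    have "tiles \<subseteq> fst ` P S"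
    proof
      fix t assume t: "t \<in> tiles"
      then obtain s where "s \<in> S (fst t)" by (auto simp: tiles_def)
      then show "t \<in> fst ` P S" using t by (force simp: P_def)
    qed
    then have fin_tiles: "finite tiles" using fin finite_surj by metis
    have tiles_I: "fst t \<in> I" if "t \<in> tiles" for t using that by (auto simp: tiles_def)
    have finS': "finite (S' i)" if "i \<in> I" for i using that S'(1) tow finite_subset by metis
    have "card (P S') = (\<Sum>t\<in>tiles. card (S' (fst t)))"
      unfolding P_def using fin_tiles tiles_I finS' by (subst card_SigmaI) auto
    also have "real \<dots> \<le> (\<Sum>t\<in>tiles. c * real (card (S (fst t))))"
      unfolding of_nat_sum by (intro sum_mono S' tiles_I)
    also have "\<dots> = c * real (card (P S))"
      unfolding P_def using fin_tiles tiles_I tow by (subst card_SigmaI) (auto simp: sum_distrib_left)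
    also have "\<dots> \<le> c * real (card F)"
      using card_image[OF inj_pt] card_mono[OF F(1) sub] c by (intro mult_left_mono) auto
    finally have PS': "real (card (P S')) \<le> c * real (card F)" .
    have finP': "finite (P S')"
      unfolding P_def using fin_tiles tiles_I finS' by blast
    have "visits F (\<Union>i\<in>I. translates \<phi> (S' i) (V i)) x \<le> card (?esc \<union> pt ` P S')"
      unfolding visits_def
    proof (intro card_mono subsetI)
      fix f assume "f \<in> {f\<in>F. \<phi> f x \<in> (\<Union>i\<in>I. translates \<phi> (S' i) (V i))}"
      then obtain i s where f: "f \<in> F" "i \<in> I" "s \<in> S' i" "\<phi> f x \<in> \<phi> s ` V i"
        by (auto simp: translates_def)
      have s: "s \<in> S i" "s \<in> carrier G" "f \<in> carrier G" using f S' tow F by blast+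
      show "f \<in> ?esc \<union> pt ` P S'"
      proof (cases "f \<in> ?esc")
        case False
        define b where "b = inv s \<otimes> f"
        have "\<phi> b x \<in> V i" using f s tow F(4) mem_translate_iff[of s "\<phi> f x" "V i"]
          by (simp add: b_def act_mult)
        moreover have "s' \<otimes> b \<in> F" if "s' \<in> S i" for s'
        proof -
          have "s' \<otimes> inv s \<in> E" using that s f unfolding E_def by force
          moreover have "s' \<in> carrier G" using that tow f by blast
          ultimately show ?thesis using False f(1) s by (auto simp: b_def m_assoc)
        qed
        ultimately have "((i, b), s) \<in> P S'" using f s by (auto simp: P_def tiles_def b_def)
        moreover have "f = pt ((i, b), s)" using s by (simp add: pt_def b_def m_assoc[symmetric])
        ultimately have "f \<in> pt ` P S'" by (rule rev_image_eqI)
        then show ?thesis by (rule UnI2)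
      qed auto
    qed (use F finP' in auto)
    also have "\<dots> \<le> card ?esc + card (P S')"
      by (rule order_trans[OF card_Un_le]) (use finP' in \<open>simp add: card_image_le\<close>)
    finally show "real (visits F (\<Union>i\<in>I. translates \<phi> (S' i) (V i)) x) \<le> (c + \<eta>) * real (card F)"
      using esc PS' by (simp add: distrib_right)
  qed (use E \<eta> in auto)
qed

end

section \<open>Actions on compact spaces\<close>

locale compact_action = set_action G X \<phi>
  for G (structure) and X :: "'x::metric_space set" and \<phi> +
  assumes compact_space: "compact X"
    and continuous_act: "g \<in> carrier G \<Longrightarrow> continuous_on X (\<phi> g)"
begin

lemma act_preimage_translate:
  assumes "g \<in> carrier G" "U \<subseteq> X"
  shows "\<phi> g ` U = X \<inter> \<phi> (inv g) -` U"
  using assms mem_translate_iff[OF assms(1) _ assms(2)] translate_subset[OF assms] by blast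

lemma openin_translate:
  assumes "g \<in> carrier G" "openin (top_of_set X) U"
  shows "openin (top_of_set X) (\<phi> g ` U)"
proof -
  have "openin (top_of_set X) (X \<inter> \<phi> (inv g) -` U)"
    by (rule continuous_openin_preimage[OF continuous_act _ assms(2)]) (use assms in auto)
  then show ?thesis using act_preimage_translate[OF assms(1)] openin_imp_subset[OF assms(2)] by simp
qed

lemma openin_translates:
  assumes "S \<subseteq> carrier G" "openin (top_of_set X) V"
  shows "openin (top_of_set X) (translates \<phi> S V)"
  unfolding translates_def using assms openin_translate by (intro openin_Union) auto

lemma closedin_complement: "openin (top_of_set X) U \<Longrightarrow> closedin (top_of_set X) (X - U)"
  using closedin_diff[OF closedin_topspace, of "top_of_set X" U] by simp

definition nbhd :: "real \<Rightarrow> 'x set \<Rightarrow> 'x set" where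
  "nbhd \<rho> A = {y\<in>X. \<exists>a\<in>A. dist y a < \<rho>}"

text \<open>For a set \<open>P\<close> of more than \<open>m\<close> elements of \<open>F\<close>, no point has all its \<open>P\<close>-translates in the closed set
\<open>A\<close>; by compactness the sum of their distances to \<open>A\<close> is then bounded away from \<open>0\<close>.  There are only
finitely many \<open>P\<close>.\<close>

lemma visits_nbhd:
  assumes F: "finite F" "F \<subseteq> carrier G" and A: "closedin (top_of_set X) A" and "m \<ge> 0"
    and le: "\<And>x. x \<in> X \<Longrightarrow> real (visits F A x) \<le> m"
  shows "\<exists>\<rho>>0. \<forall>x\<in>X. real (visits F (nbhd \<rho> A) x) \<le> m"
proof (cases "A = {} \<or> X = {}")
  case True
  then show ?thesis using le by (auto intro!: exI[of _ "1::real"] simp: nbhd_def visits_def \<open>m \<ge> 0\<close>)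
next
  case False
  have clA: "closed A" using closedin_compact[OF compact_space A] compact_imp_closed by blast
  have "\<exists>\<rho>>0. \<forall>x\<in>X. \<exists>f\<in>P. infdist (\<phi> f x) A \<ge> \<rho>" if P: "P \<in> {P\<in>Pow F. real (card P) > m}" for P
  proof -
    have finP: "finite P" "P \<subseteq> carrier G" "P \<subseteq> F" using P F finite_subset by auto
    define s where "s x = (\<Sum>f\<in>P. infdist (\<phi> f x) A)" for x
    have "continuous_on X s" unfolding s_def
      by (intro continuous_intros continuous_act) (use finP in auto)
    then obtain x0 where x0: "x0 \<in> X" "\<And>x. x \<in> X \<Longrightarrow> s x0 \<le> s x"
      using continuous_attains_inf[OF compact_space] False by blast
    have cP: "card P > 0" using P \<open>m \<ge> 0\<close> by auto
    have "\<exists>f\<in>P. \<phi> f x0 \<notin> A"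
    proof (rule ccontr)
      assume "\<not> ?thesis"
      then have "P \<subseteq> {f\<in>F. \<phi> f x0 \<in> A}" using finP by auto
      then have "card P \<le> visits F A x0" unfolding visits_def using F by (intro card_mono) auto
      then show False using le[OF x0(1)] P by simp
    qed
    then obtain f where f: "f \<in> P" "\<phi> f x0 \<notin> A" by blast
    then have "0 < infdist (\<phi> f x0) A"
      using clA False infdist_pos_not_in_closed by blast
    also have "\<dots> \<le> s x0" unfolding s_def
      by (rule member_le_sum) (use finP f in \<open>auto simp: infdist_nonneg\<close>)
    finally have pos: "s x0 > 0" .
    show ?thesis
    proof (intro exI[of _ "s x0 / card P"] conjI ballI)
      show "0 < s x0 / card P" using pos cP by simp
      fix x assume x: "x \<in> X"
      show "\<exists>f\<in>P. s x0 / card P \<le> infdist (\<phi> f x) A"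
      proof (rule ccontr)
        assume "\<not> ?thesis"
        then have "s x < (\<Sum>f\<in>P. s x0 / card P)" unfolding s_def
          by (intro sum_strict_mono) (use finP cP in \<open>auto simp: not_le\<close>)
        also have "\<dots> = s x0" using cP by simp
        finally show False using x0(2)[OF x] by simp
      qed
    qed
  qed
  then obtain r where r: "\<And>P. P \<in> {P\<in>Pow F. real (card P) > m} \<Longrightarrow>
      r P > 0 \<and> (\<forall>x\<in>X. \<exists>f\<in>P. infdist (\<phi> f x) A \<ge> r P)"
    by metis
  define \<rho> where "\<rho> = Min (insert 1 (r ` {P\<in>Pow F. real (card P) > m}))"
  have fin: "finite (insert 1 (r ` {P\<in>Pow F. real (card P) > m}))" using F by simp
  have \<rho>_le: "\<rho> \<le> r P" if "P \<in> {P\<in>Pow F. real (card P) > m}" for P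
    unfolding \<rho>_def using fin that by (intro Min_le) blast+
  have "\<rho> > 0" unfolding \<rho>_def using fin r by (subst Min_gr_iff) auto
  moreover have "real (visits F (nbhd \<rho> A) x) \<le> m" if x: "x \<in> X" for x
  proof (rule ccontr)
    let ?P = "{f\<in>F. \<phi> f x \<in> nbhd \<rho> A}"
    assume "\<not> ?thesis"
    then have P: "?P \<in> {P\<in>Pow F. real (card P) > m}" by (auto simp: visits_def)
    then obtain f where f: "f \<in> ?P" "infdist (\<phi> f x) A \<ge> r ?P" using r[OF P] x by blast
    then obtain a where "a \<in> A" "dist (\<phi> f x) a < \<rho>" by (auto simp: nbhd_def)
    then have "infdist (\<phi> f x) A < \<rho>" using infdist_le[of a A "\<phi> f x"] by linarith
    moreover have "\<rho> \<le> r ?P" using \<rho>_le[OF P] .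
    ultimately show False using f by linarith
  qed
  ultimately show ?thesis by blast
qed

lemma subequivalentE:
  assumes "subequivalent G X \<phi> A B" "closedin (top_of_set X) C" "C \<subseteq> A"
  obtains m :: nat and U s where
    "\<And>j. j < m \<Longrightarrow> openin (top_of_set X) (U j)" "\<And>j. j < m \<Longrightarrow> s j \<in> carrier G"
    "C \<subseteq> (\<Union>j<m. U j)" "disjoint_family_on (\<lambda>j. \<phi> (s j) ` U j) {..<m}"
    "\<And>j. j < m \<Longrightarrow> \<phi> (s j) ` U j \<subseteq> B"
proof -
  have pre: "closedin (top_of_set X) C \<and> C \<subseteq> A" using assms by blast
  obtain m :: nat and U s where *:
    "(\<forall>j<m. openin (top_of_set X) (U j) \<and> s j \<in> carrier G) \<and> C \<subseteq> (\<Union>j<m. U j) \<and>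
      disjoint_family_on (\<lambda>j. \<phi> (s j) ` U j) {..<m} \<and> (\<forall>j<m. \<phi> (s j) ` U j \<subseteq> B)"
    using assms(1)[unfolded subequivalent_def, THEN spec, THEN mp, OF pre] by (elim exE)
  show ?thesis by (rule that[of m U s]) (use * in blast)+
qed

text \<open>The definition of subequivalence indexes the moved pieces by an initial segment of the natural numbers;
here any finite index set is allowed.\<close>

lemma finite_moving_family:
  assumes J: "finite J"
    and U: "\<And>j. j \<in> J \<Longrightarrow> openin (top_of_set X) (U j)" and s: "\<And>j. j \<in> J \<Longrightarrow> s j \<in> carrier G"
    and C: "C \<subseteq> (\<Union>j\<in>J. U j)"
    and disj: "disjoint_family_on (\<lambda>j. \<phi> (s j) ` U j) J"
    and B: "\<And>j. j \<in> J \<Longrightarrow> \<phi> (s j) ` U j \<subseteq> B"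
  shows "\<exists>(m::nat) U s. (\<forall>j<m. openin (top_of_set X) (U j) \<and> s j \<in> carrier G) \<and>
          C \<subseteq> (\<Union>j<m. U j) \<and> disjoint_family_on (\<lambda>j. \<phi> (s j) ` U j) {..<m} \<and>
          (\<forall>j<m. \<phi> (s j) ` U j \<subseteq> B)"
proof -
  obtain h where h: "bij_betw h {0..<card J} J" using ex_bij_betw_nat_finite[OF J] by blast
  have hJ: "h k \<in> J" if "k < card J" for k using bij_betw_apply[OF h] that by simp
  show ?thesis
  proof (rule exI[of _ "card J"], rule exI[of _ "\<lambda>k. U (h k)"], rule exI[of _ "\<lambda>k. s (h k)"], intro conjI)
    show "C \<subseteq> (\<Union>k<card J. U (h k))"
    proof
      fix x assume "x \<in> C"
      then obtain j where "j \<in> J" "x \<in> U j" using C by blast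
      moreover then obtain k where "k < card J" "j = h k"
        using h unfolding bij_betw_def by (metis atLeastLessThan_iff image_iff)
      ultimately show "x \<in> (\<Union>k<card J. U (h k))" by blast
    qed
    have "h k \<noteq> h l" if "k < card J" "l < card J" "k \<noteq> l" for k l
      using h that unfolding bij_betw_def inj_on_def by auto
    then show "disjoint_family_on (\<lambda>k. \<phi> (s (h k)) ` U (h k)) {..<card J}"
      using disj hJ unfolding disjoint_family_on_def by simp
  qed (use U s B hJ in auto)
qed

end

locale almost_finite_action = compact_action +
  assumes almost_finite: "almost_finite G X \<phi>"
begin

text \<open>The remainder is moved into the levels in \<open>S'\<close>, which form a small proportion of each tower, so it has
small density itself.  This is how almost finiteness enters most of the arguments below.\<close>

lemma castle_with_small_remainder:
  fixes \<eta> \<rho> \<epsilon> :: real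
  assumes K: "finite K" "K \<subseteq> carrier G" and pos: "\<eta> > 0" "\<rho> > 0" "\<epsilon> > 0"
  obtains I :: "nat set" and S V S' where
    "open_castle G X \<phi> I S V" "\<And>i. i \<in> I \<Longrightarrow> invariant_set G K \<eta> (S i)"
    "\<And>i s. i \<in> I \<Longrightarrow> s \<in> S i \<Longrightarrow> diameter (\<phi> s ` V i) < \<rho>"
    "\<And>i. i \<in> I \<Longrightarrow> S' i \<subseteq> S i" "\<And>i. i \<in> I \<Longrightarrow> real (card (S' i)) \<le> \<epsilon> * real (card (S i))"
    "closedin (top_of_set X) (X - (\<Union>i\<in>I. translates \<phi> (S i) (V i)))"
    "subequivalent G X \<phi> (X - (\<Union>i\<in>I. translates \<phi> (S i) (V i))) (\<Union>i\<in>I. translates \<phi> (S' i) (V i))"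
    "density_le (X - (\<Union>i\<in>I. translates \<phi> (S i) (V i))) \<epsilon>"
proof -
  \<comment> \<open>The remainder gets density at most \<open>1 / n\<close> plus two errors \<open>\<epsilon> / 4\<close>: one for counting along
    towers and one for moving.\<close>
  obtain n :: nat where n: "n \<ge> 1" "1 / real n \<le> \<epsilon> / 2"
  proof -
    obtain k :: nat where k: "2 / \<epsilon> < real k" using reals_Archimedean2 by blast
    have k1: "real k > 0" using k pos by (meson divide_pos_pos less_trans zero_less_numeral)
    then have "1 / real k \<le> \<epsilon> / 2" using k pos by (simp add: field_simps)
    then show ?thesis using that[of k] k1 by simp
  qed
  define \<delta> where "\<delta> = min \<eta> \<rho>"
  have "\<delta> > 0" using pos by (simp add: \<delta>_def)
  with n(1) K have pre: "n \<ge> 1 \<and> finite K \<and> K \<subseteq> carrier G \<and> \<delta> > 0" by blast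
  obtain I :: "nat set" and S V S' where
    *: "open_castle G X \<phi> I S V \<and> (\<forall>i\<in>I. invariant_set G K \<delta> (S i)) \<and>
      (\<forall>i\<in>I. \<forall>s\<in>S i. diameter (\<phi> s ` V i) < \<delta>) \<and>
      (\<forall>i\<in>I. S' i \<subseteq> S i \<and> real (card (S' i)) \<le> real (card (S i)) / real n) \<and>
      subequivalent G X \<phi> (X - (\<Union>i\<in>I. translates \<phi> (S i) (V i))) (\<Union>i\<in>I. translates \<phi> (S' i) (V i))"
    using almost_finite[unfolded almost_finite_def, THEN spec, THEN spec, THEN spec, THEN mp, OF pre]
    by (elim exE)
  then have oc: "open_castle G X \<phi> I S V" and inv: "\<And>i. i \<in> I \<Longrightarrow> invariant_set G K \<delta> (S i)" and
    diam: "\<And>i s. i \<in> I \<Longrightarrow> s \<in> S i \<Longrightarrow> diameter (\<phi> s ` V i) < \<delta>" and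
    S': "\<And>i. i \<in> I \<Longrightarrow> S' i \<subseteq> S i" "\<And>i. i \<in> I \<Longrightarrow> real (card (S' i)) \<le> real (card (S i)) / real n" and
    sub: "subequivalent G X \<phi> (X - (\<Union>i\<in>I. translates \<phi> (S i) (V i))) (\<Union>i\<in>I. translates \<phi> (S' i) (V i))"
    by blast+
  have S: "finite (S i)" "S i \<subseteq> carrier G" "openin (top_of_set X) (V i)" if "i \<in> I" for i
    using oc that by (auto simp: open_castle_def castle_def tower_def)
  have "openin (top_of_set X) (\<Union>i\<in>I. translates \<phi> (S i) (V i))"
    using S openin_translates by (intro openin_Union) auto
  then have closed: "closedin (top_of_set X) (X - (\<Union>i\<in>I. translates \<phi> (S i) (V i)))"
    by (rule closedin_complement)
  have "density_le (\<Union>i\<in>I. translates \<phi> (S' i) (V i)) (1 / real n + \<epsilon> / 4)"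
    by (rule density_le_subtowers[where S = S]) (use oc S' pos in \<open>auto simp: open_castle_def\<close>)
  moreover obtain m :: nat and U s where
    m: "\<And>j. j < m \<Longrightarrow> openin (top_of_set X) (U j)" "\<And>j. j < m \<Longrightarrow> s j \<in> carrier G"
       "X - (\<Union>i\<in>I. translates \<phi> (S i) (V i)) \<subseteq> (\<Union>j<m. U j)"
       "disjoint_family_on (\<lambda>j. \<phi> (s j) ` U j) {..<m}"
       "\<And>j. j < m \<Longrightarrow> \<phi> (s j) ` U j \<subseteq> (\<Union>i\<in>I. translates \<phi> (S' i) (V i))"
    by (rule subequivalentE[OF sub closed order_refl]) (rule that)
  moreover have "U j \<subseteq> X" if "j < m" for j using openin_imp_subset[OF m(1)[OF that]] .
  ultimately have "density_le (X - (\<Union>i\<in>I. translates \<phi> (S i) (V i))) ((1 / real n + \<epsilon> / 4) + \<epsilon> / 4)"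
    using pos by (intro density_le_moved_into[OF finite_lessThan, of m s U, OF _ _ m(4) _ m(3)])
      (simp_all add: m(2,5))
  then have "density_le (X - (\<Union>i\<in>I. translates \<phi> (S i) (V i))) \<epsilon>"
    by (rule density_le_mono) (use n in auto)
  moreover have "invariant_set G K \<eta> (S i)" if "i \<in> I" for i
    by (rule invariant_set_mono[OF K(1) S(1)[OF that] K(2) _ _ inv[OF that]]) (auto simp: \<delta>_def)
  moreover have "diameter (\<phi> s ` V i) < \<rho>" if "i \<in> I" "s \<in> S i" for i s
    using diam[OF that] by (simp add: \<delta>_def)
  moreover have "real (card (S' i)) \<le> \<epsilon> * real (card (S i))" if "i \<in> I" for i
  proof -
    have "real (card (S' i)) \<le> (1 / real n) * real (card (S i))" using S'(2)[OF that] by simp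
    also have "\<dots> \<le> \<epsilon> * real (card (S i))" using n pos by (intro mult_right_mono) auto
    finally show ?thesis .
  qed
  ultimately show ?thesis using oc S'(1) closed sub by (intro that) auto
qed

text \<open>The shapes of castles provide invariant sets; if all shapes were empty, the whole space would be
subequivalent to the empty set.\<close>

lemma invariant_set_exists:
  fixes \<eta> :: real
  assumes K: "finite K" "K \<subseteq> carrier G" and "\<eta> > 0" "X \<noteq> {}"
  obtains F where "finite F" "F \<noteq> {}" "F \<subseteq> carrier G" "invariant_set G K \<eta> F"
proof -
  obtain I :: "nat set" and S V S' where c:
    "open_castle G X \<phi> I S V" "\<And>i. i \<in> I \<Longrightarrow> invariant_set G K \<eta> (S i)"
    "\<And>i. i \<in> I \<Longrightarrow> S' i \<subseteq> S i"
    "closedin (top_of_set X) (X - (\<Union>i\<in>I. translates \<phi> (S i) (V i)))"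
    "subequivalent G X \<phi> (X - (\<Union>i\<in>I. translates \<phi> (S i) (V i))) (\<Union>i\<in>I. translates \<phi> (S' i) (V i))"
    by (rule castle_with_small_remainder[OF K \<open>\<eta> > 0\<close> zero_less_one zero_less_one]) (rule that)
  have "\<exists>i\<in>I. S i \<noteq> {}"
  proof (rule ccontr)
    assume "\<not> ?thesis"
    then have *: "S i = {}" "S' i = {}" if "i \<in> I" for i using that c(3) by blast+
    then have "subequivalent G X \<phi> X {}" using c(5) by (simp add: translates_def)
    moreover have "closedin (top_of_set X) X" by simp
    ultimately obtain m :: nat and U and s :: "nat \<Rightarrow> 'a" where
      "X \<subseteq> (\<Union>j<m. U j)" "\<And>j. j < m \<Longrightarrow> \<phi> (s j) ` U j \<subseteq> {}"
      using order_refl by (rule subequivalentE) (rule that)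
    then show False using \<open>X \<noteq> {}\<close> by auto
  qed
  then obtain i where "i \<in> I" "S i \<noteq> {}" by blast
  then show ?thesis using that[of "S i"] c by (auto simp: open_castle_def castle_def tower_def)
qed

text \<open>A density bound is witnessed by a single invariant set, up to an error, and for a single finite set compactness
allows the closed set to be enlarged.\<close>

lemma density_le_nbhd:
  fixes a \<eta> :: real
  assumes "density_le A a" "closedin (top_of_set X) A" "\<eta> > 0"
  obtains \<rho> :: real where "\<rho> > 0" "density_le (nbhd \<rho> A) (a + \<eta>)"
proof (cases "X = {}")
  case True
  then have "density_le (nbhd 1 A) (a + \<eta>)" by (intro density_leI[of "{}" 1]) auto
  then show ?thesis using that[of 1] by simp
next
  case False
  obtain E and \<eta>' :: real where E: "finite E" "E \<subseteq> carrier G" "\<eta>' > 0"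
    and *: "\<And>F x. finite F \<Longrightarrow> F \<subseteq> carrier G \<Longrightarrow> invariant_set G E \<eta>' F \<Longrightarrow> x \<in> X
        \<Longrightarrow> real (visits F A x) \<le> a * real (card F)"
    by (rule density_leE[OF assms(1)]) (rule that)
  obtain F where F: "finite F" "F \<noteq> {}" "F \<subseteq> carrier G" "invariant_set G E \<eta>' F"
    by (rule invariant_set_exists[OF E False]) (rule that)
  have le: "real (visits F A x) \<le> a * real (card F)" if "x \<in> X" for x using * F that by blast
  have "0 \<le> a * real (card F)" using le False by (meson ex_in_conv of_nat_0_le_iff order_trans)
  then obtain \<rho> where "\<rho> > 0" "\<And>x. x \<in> X \<Longrightarrow> real (visits F (nbhd \<rho> A) x) \<le> a * real (card F)"
    using visits_nbhd[OF F(1,3) assms(2)] le by meson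
  then show ?thesis using that density_leI_single[OF F(1-3) \<open>\<eta> > 0\<close>] by blast
qed

end

section \<open>Comparison for almost finite actions\<close>

context almost_finite_action
begin

text \<open>If \<open>C\<close> is less dense than \<open>B\<close>, then \<open>C\<close> can be moved into \<open>B\<close>.  Choose a castle with levels so small
that each level meeting \<open>C\<close> lies in a neighbourhood of \<open>C\<close> and each level meeting the complement of \<open>B\<close>
lies in a neighbourhood of that complement, where both neighbourhoods satisfy nearly the same density bounds as the original sets.
Counting visits of a base point then shows that each tower has at least as many levels inside \<open>B\<close> as it
has levels meeting \<open>C\<close> and levels in \<open>S'\<close> together.  So the levels meeting \<open>C\<close> can be moved to levels
inside \<open>B\<close>, and the part of \<open>C\<close> in the remainder is first moved into the levels in \<open>S'\<close> and from there
to the levels of \<open>B\<close> that are still free.\<close>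

lemma comparison:
  fixes a b :: real
  assumes C: "closedin (top_of_set X) C" "density_le C a"
    and B: "openin (top_of_set X) B" "density_le (X - B) b" and "a + b < 1"
  shows "\<exists>(m::nat) U s. (\<forall>j<m. openin (top_of_set X) (U j) \<and> s j \<in> carrier G) \<and>
          C \<subseteq> (\<Union>j<m. U j) \<and> disjoint_family_on (\<lambda>j. \<phi> (s j) ` U j) {..<m} \<and>
          (\<forall>j<m. \<phi> (s j) ` U j \<subseteq> B)"
proof -
  define \<epsilon> where "\<epsilon> = (1 - a - b) / 3"
  have \<epsilon>: "\<epsilon> > 0" "(a + \<epsilon>) + (b + \<epsilon>) + \<epsilon> = 1" using \<open>a + b < 1\<close> unfolding \<epsilon>_def by (simp, argo)
  obtain \<rho>1 :: real where \<rho>1: "\<rho>1 > 0" "density_le (nbhd \<rho>1 C) (a + \<epsilon>)"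
    by (rule density_le_nbhd[OF C(2,1) \<epsilon>(1)]) (rule that)
  obtain \<rho>2 :: real where \<rho>2: "\<rho>2 > 0" "density_le (nbhd \<rho>2 (X - B)) (b + \<epsilon>)"
    by (rule density_le_nbhd[OF B(2) closedin_complement[OF B(1)] \<epsilon>(1)]) (rule that)
  obtain E1 and \<eta>1 :: real where E1: "finite E1" "E1 \<subseteq> carrier G" "\<eta>1 > 0"
    and visC: "\<And>F x. finite F \<Longrightarrow> F \<subseteq> carrier G \<Longrightarrow> invariant_set G E1 \<eta>1 F \<Longrightarrow> x \<in> X
        \<Longrightarrow> real (visits F (nbhd \<rho>1 C) x) \<le> (a + \<epsilon>) * real (card F)"
    by (rule density_leE[OF \<rho>1(2)]) (rule that)
  obtain E2 and \<eta>2 :: real where E2: "finite E2" "E2 \<subseteq> carrier G" "\<eta>2 > 0"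
    and visB: "\<And>F x. finite F \<Longrightarrow> F \<subseteq> carrier G \<Longrightarrow> invariant_set G E2 \<eta>2 F \<Longrightarrow> x \<in> X
        \<Longrightarrow> real (visits F (nbhd \<rho>2 (X - B)) x) \<le> (b + \<epsilon>) * real (card F)"
    by (rule density_leE[OF \<rho>2(2)]) (rule that)
  have KK: "finite (E1 \<union> E2)" "E1 \<union> E2 \<subseteq> carrier G" "min \<eta>1 \<eta>2 > 0" "min \<rho>1 \<rho>2 > 0"
    using E1 E2 \<rho>1 \<rho>2 by auto
  obtain I :: "nat set" and S V S' where
    oc: "open_castle G X \<phi> I S V" and inv: "\<And>i. i \<in> I \<Longrightarrow> invariant_set G (E1 \<union> E2) (min \<eta>1 \<eta>2) (S i)"
    and diam: "\<And>i s. i \<in> I \<Longrightarrow> s \<in> S i \<Longrightarrow> diameter (\<phi> s ` V i) < min \<rho>1 \<rho>2"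
    and S': "\<And>i. i \<in> I \<Longrightarrow> S' i \<subseteq> S i" "\<And>i. i \<in> I \<Longrightarrow> real (card (S' i)) \<le> \<epsilon> * real (card (S i))"
    and R: "closedin (top_of_set X) (X - (\<Union>i\<in>I. translates \<phi> (S i) (V i)))"
      "subequivalent G X \<phi> (X - (\<Union>i\<in>I. translates \<phi> (S i) (V i))) (\<Union>i\<in>I. translates \<phi> (S' i) (V i))"
    by (rule castle_with_small_remainder[OF KK \<epsilon>(1)]) (rule that)
  define R where "R = X - (\<Union>i\<in>I. translates \<phi> (S i) (V i))"
  have I: "finite I" and S: "\<And>i. i \<in> I \<Longrightarrow> finite (S i)" "\<And>i. i \<in> I \<Longrightarrow> S i \<subseteq> carrier G"
    and V: "\<And>i. i \<in> I \<Longrightarrow> openin (top_of_set X) (V i)" "\<And>i. i \<in> I \<Longrightarrow> V i \<subseteq> X"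
    using oc by (auto simp: open_castle_def castle_def tower_def)
  have unique: "i = i' \<and> s = s'"
    if "i \<in> I" "i' \<in> I" "s \<in> S i" "s' \<in> S i'" "y \<in> \<phi> s ` V i" "y \<in> \<phi> s' ` V i'" for i i' s s' y
    using castle_levels_unique oc that unfolding open_castle_def by metis
  have CX: "C \<subseteq> X" using closedin_imp_subset[OF C(1)] .
  define M where "M i = {s\<in>S i. \<phi> s ` V i \<inter> C \<noteq> {}}" for i
  define N where "N i = {s\<in>S i. \<phi> s ` V i \<subseteq> B}" for i
  have close: "y \<in> nbhd \<rho>1 A \<and> y \<in> nbhd \<rho>2 A"
    if "i \<in> I" "s \<in> S i" "y \<in> \<phi> s ` V i" "z \<in> \<phi> s ` V i" "z \<in> A" for i s y z A
  proof -
    have sub: "\<phi> s ` V i \<subseteq> X" using that S V by (intro translate_subset) auto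
    then have "bounded (\<phi> s ` V i)" using compact_imp_bounded[OF compact_space] bounded_subset by blast
    then have "dist y z \<le> diameter (\<phi> s ` V i)" using diameter_bounded_bound that by blast
    also have "\<dots> < min \<rho>1 \<rho>2" using diam that by blast
    finally show ?thesis using that sub by (auto simp: nbhd_def)
  qed
  have finite_slots: "finite (M i)" "finite (N i)" "finite (S' i)" if "i \<in> I" for i
    using S(1)[OF that] finite_subset[OF S'(1)[OF that]] by (auto simp: M_def N_def)
  have "\<exists>f. f ` (M i <+> S' i) \<subseteq> N i \<and> inj_on f (M i <+> S' i)" if i: "i \<in> I" for i
  proof (rule card_le_inj)
    note fin = finite_slots[OF i]
    then show "finite (M i <+> S' i)" "finite (N i)" by auto
    show "card (M i <+> S' i) \<le> card (N i)"
    proof (cases "V i = {}")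
      case True
      then have "M i = {}" "N i = S i" by (auto simp: M_def N_def)
      then show ?thesis using card_mono[OF S(1)[OF i] S'(1)[OF i]] fin(3)
        by (simp add: card_Plus)
    next
      case False
      then obtain v where v: "v \<in> V i" "v \<in> X" using V i by blast
      have inv': "invariant_set G E1 \<eta>1 (S i)" "invariant_set G E2 \<eta>2 (S i)"
        by (rule invariant_set_mono[OF KK(1) S(1)[OF i] KK(2) _ _ inv[OF i]]; simp)+
      have "card (M i) \<le> visits (S i) (nbhd \<rho>1 C) v"
        unfolding visits_def
      proof (intro card_mono subsetI)
        fix s assume "s \<in> M i"
        then obtain z where "s \<in> S i" "z \<in> \<phi> s ` V i" "z \<in> C" by (auto simp: M_def)
        then show "s \<in> {s\<in>S i. \<phi> s v \<in> nbhd \<rho>1 C}" using close[OF i] v by blast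
      qed (use S i in auto)
      then have 1: "real (card (M i)) \<le> (a + \<epsilon>) * real (card (S i))"
        using visC[OF S(1,2)[OF i] inv'(1) v(2)] by linarith
      have "card (S i - N i) \<le> visits (S i) (nbhd \<rho>2 (X - B)) v"
        unfolding visits_def
      proof (intro card_mono subsetI)
        fix s assume "s \<in> S i - N i"
        then obtain z where z: "s \<in> S i" "z \<in> \<phi> s ` V i" "z \<notin> B" by (auto simp: N_def)
        moreover have "z \<in> X" using z S[OF i] V[OF i] by auto
        ultimately show "s \<in> {s\<in>S i. \<phi> s v \<in> nbhd \<rho>2 (X - B)}" using close[OF i] v by blast
      qed (use S i in auto)
      then have 2: "real (card (S i - N i)) \<le> (b + \<epsilon>) * real (card (S i))"
        using visB[OF S(1,2)[OF i] inv'(2) v(2)] by linarith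
      have "N i \<subseteq> S i" by (auto simp: N_def)
      then have 3: "real (card (S i - N i)) = real (card (S i)) - real (card (N i))"
        using fin S(1)[OF i] by (simp add: card_Diff_subset card_mono of_nat_diff)
      have "real (card (S i)) = ((a + \<epsilon>) + (b + \<epsilon>) + \<epsilon>) * real (card (S i))" using \<epsilon>(2) by simp
      then have "real (card (M i)) + real (card (S' i)) \<le> real (card (N i))"
        using 1 2 3 S'(2)[OF i] unfolding distrib_right by linarith
      then show ?thesis using fin by (simp add: card_Plus)
    qed
  qed
  then obtain \<sigma> where \<sigma>: "\<And>i p. i \<in> I \<Longrightarrow> p \<in> M i <+> S' i \<Longrightarrow> \<sigma> i p \<in> N i"
    and \<sigma>_inj: "\<And>i. i \<in> I \<Longrightarrow> inj_on (\<sigma> i) (M i <+> S' i)"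
    by (metis image_subset_iff)
  have "closedin (top_of_set X) (C \<inter> R)" using C(1) R(1) unfolding R_def by (rule closedin_Int)
  then obtain m :: nat and U r where
    U: "\<And>j. j < m \<Longrightarrow> openin (top_of_set X) (U j)" and r: "\<And>j. j < m \<Longrightarrow> r j \<in> carrier G"
    and cover: "C \<inter> R \<subseteq> (\<Union>j<m. U j)"
    and disj: "disjoint_family_on (\<lambda>j. \<phi> (r j) ` U j) {..<m}"
    and into: "\<And>j. j < m \<Longrightarrow> \<phi> (r j) ` U j \<subseteq> (\<Union>i\<in>I. translates \<phi> (S' i) (V i))"
    by (rule subequivalentE[OF R(2)[folded R_def] _ Int_lower2]) (rule that)
  \<comment> \<open>The piece \<open>(i, Inl t)\<close> is a level meeting \<open>C\<close>; the piece \<open>(i, Inr (j, t))\<close> is the part of \<open>U j\<close>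
    that \<open>r j\<close> moves into the level \<open>t\<close>. Its destination does not depend on \<open>j\<close>, as the \<open>r j\<close> have already
    separated these parts.\<close>
  define J where "J = (SIGMA i:I. M i <+> ({..<m} \<times> S' i))"
  define slot where "slot = map_sum (id :: 'a \<Rightarrow> 'a) (snd :: nat \<times> 'a \<Rightarrow> 'a)"
  define piece where "piece = (\<lambda>(i, p). case p of
      Inl t \<Rightarrow> \<phi> t ` V i | Inr (j, t) \<Rightarrow> U j \<inter> \<phi> (inv (r j) \<otimes> t) ` V i)"
  define mover where "mover = (\<lambda>(i, p). case p of
      Inl t \<Rightarrow> \<sigma> i (slot p) \<otimes> inv t | Inr (j, t) \<Rightarrow> \<sigma> i (slot p) \<otimes> inv t \<otimes> r j)"
  have slot: "slot p \<in> M i <+> S' i" if "(i, p) \<in> J" for i p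
    using that by (auto simp: J_def slot_def)
  have target: "\<sigma> i (slot p) \<in> N i" "\<sigma> i (slot p) \<in> S i" "\<sigma> i (slot p) \<in> carrier G" "i \<in> I"
    if "(i, p) \<in> J" for i p
  proof -
    show i: "i \<in> I" using that by (simp add: J_def)
    show N: "\<sigma> i (slot p) \<in> N i" using \<sigma>[OF i slot[OF that]] .
    then show "\<sigma> i (slot p) \<in> S i" by (simp add: N_def)
    then show "\<sigma> i (slot p) \<in> carrier G" using S(2)[OF i] by blast
  qed
  have MS: "M i \<subseteq> carrier G" "S' i \<subseteq> carrier G" if "i \<in> I" for i
    using S(2)[OF that] S'(1)[OF that] by (auto simp: M_def)
  have mover: "\<phi> (mover (i, p)) ` piece (i, p) \<subseteq> \<phi> (\<sigma> i (slot p)) ` V i" if ip: "(i, p) \<in> J" for i p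
  proof (cases p)
    case (Inl t)
    then have t: "t \<in> carrier G" using ip MS by (auto simp: J_def)
    have "\<phi> (\<sigma> i (slot p) \<otimes> inv t) (\<phi> t v) = \<phi> (\<sigma> i (slot p)) v" if "v \<in> V i" for v
    proof -
      have "v \<in> X" using V target(4)[OF ip] that by blast
      then show ?thesis using t target(3)[OF ip] by (simp add: act_mult)
    qed
    then show ?thesis using Inl by (auto simp: mover_def piece_def)
  next
    case (Inr q)
    then obtain j t where p: "p = Inr (j, t)" by (cases q) auto
    then have t: "t \<in> carrier G" "r j \<in> carrier G" using ip MS r by (auto simp: J_def)
    have "\<phi> (\<sigma> i (slot p) \<otimes> inv t \<otimes> r j) (\<phi> (inv (r j) \<otimes> t) v) = \<phi> (\<sigma> i (slot p)) v" if "v \<in> V i" for v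
    proof -
      have "v \<in> X" using V target(4)[OF ip] that by blast
      then show ?thesis using t target(3)[OF ip] by (simp add: act_mult)
    qed
    then show ?thesis using p by (auto simp: mover_def piece_def)
  qed
  show ?thesis
  proof (rule finite_moving_family)
    show "finite J"
      unfolding J_def using I finite_slots by (intro finite_SigmaI finite_Plus finite_cartesian_product) auto
  next
    fix p assume p: "p \<in> J"
    obtain i q where ip: "p = (i, q)" by (cases p) auto
    note p = p[unfolded ip]
    show "openin (top_of_set X) (piece p)"
    proof (cases q)
      case (Inl t)
      then have it: "i \<in> I" "t \<in> M i" using p by (auto simp: J_def)
      then have "openin (top_of_set X) (\<phi> t ` V i)" using MS(1)[OF it(1)] V(1) openin_translate by blast
      then show ?thesis using Inl by (simp add: ip piece_def)
    next
      case (Inr u)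
      obtain j t where "u = (j, t)" by (cases u) auto
      then have jt: "q = Inr (j, t)" "j < m" "i \<in> I" "t \<in> S' i" using p Inr by (auto simp: J_def)
      then have "inv (r j) \<otimes> t \<in> carrier G" using MS(2)[OF jt(3)] r by auto
      then have "openin (top_of_set X) (U j \<inter> \<phi> (inv (r j) \<otimes> t) ` V i)"
        using U V openin_translate jt by (intro openin_Int) auto
      then show ?thesis by (simp add: ip jt(1) piece_def)
    qed
    show "mover p \<in> carrier G"
    proof (cases q)
      case (Inl t)
      then have "t \<in> carrier G" using p MS by (auto simp: J_def)
      then show ?thesis using target(3)[OF p] Inl by (simp add: ip mover_def)
    next
      case (Inr u)
      obtain j t where "u = (j, t)" by (cases u) auto
      then have "q = Inr (j, t)" "t \<in> carrier G" "r j \<in> carrier G"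
        using p Inr MS r by (auto simp: J_def)
      then show ?thesis using target(3)[OF p] by (simp add: ip mover_def)
    qed
    show "\<phi> (mover p) ` piece p \<subseteq> B"
      using mover[OF p] target(1)[OF p] ip by (auto simp: N_def)
  next
    show "C \<subseteq> (\<Union>p\<in>J. piece p)"
    proof
      fix x assume x: "x \<in> C"
      show "x \<in> (\<Union>p\<in>J. piece p)"
      proof (cases "x \<in> R")
        case True
        then obtain j where j: "j < m" "x \<in> U j" using cover x by blast
        then have "\<phi> (r j) x \<in> \<phi> (r j) ` U j" by blast
        then obtain i t where it: "i \<in> I" "t \<in> S' i" "\<phi> (r j) x \<in> \<phi> t ` V i"
          using into[OF j(1)] unfolding translates_def by blast
        then obtain v where v: "v \<in> V i" "\<phi> (r j) x = \<phi> t v" by blast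
        have c: "t \<in> carrier G" "r j \<in> carrier G" "x \<in> X" "v \<in> X"
          using it MS(2)[OF it(1)] r[OF j(1)] CX x V(2)[OF it(1)] v by auto
        have "x = \<phi> (inv (r j)) (\<phi> (r j) x)" using c by simp
        also have "\<dots> = \<phi> (inv (r j) \<otimes> t) v" using c by (simp add: act_mult v(2))
        finally have "x \<in> piece (i, Inr (j, t))" using j v(1) by (auto simp: piece_def)
        moreover have "(i, Inr (j, t)) \<in> J" using it j by (auto simp: J_def)
        ultimately show ?thesis by blast
      next
        case False
        then obtain i t where it: "i \<in> I" "t \<in> S i" "x \<in> \<phi> t ` V i"
          using x CX unfolding R_def translates_def by blast
        then have "(i, Inl t) \<in> J" using x by (auto simp: J_def M_def)
        moreover have "x \<in> piece (i, Inl t)" using it by (simp add: piece_def)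
        ultimately show ?thesis by blast
      qed
    qed
  next
    show "disjoint_family_on (\<lambda>p. \<phi> (mover p) ` piece p) J"
      unfolding disjoint_family_on_def
    proof (intro ballI impI)
      fix p p' assume pp: "p \<in> J" "p' \<in> J" "p \<noteq> p'"
      obtain i q where ip: "p = (i, q)" by (cases p) auto
      obtain i' q' where ip': "p' = (i', q')" by (cases p') auto
      show "\<phi> (mover p) ` piece p \<inter> \<phi> (mover p') ` piece p' = {}"
      proof (rule ccontr)
        assume "\<not> ?thesis"
        then obtain y where y: "y \<in> \<phi> (mover p) ` piece p" "y \<in> \<phi> (mover p') ` piece p'" by blast
        have J: "(i, q) \<in> J" "(i', q') \<in> J" using pp ip ip' by auto
        have eq: "i = i' \<and> \<sigma> i (slot q) = \<sigma> i' (slot q')"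
        proof (rule unique)
          show "y \<in> \<phi> (\<sigma> i (slot q)) ` V i" using mover[OF J(1)] y(1) unfolding ip by (rule subsetD)
          show "y \<in> \<phi> (\<sigma> i' (slot q')) ` V i'" using mover[OF J(2)] y(2) unfolding ip' by (rule subsetD)
        qed (use target[OF J(1)] target[OF J(2)] in simp_all)
        then have ii: "i' = i" by simp
        have \<sigma>\<sigma>: "\<sigma> i (slot q) = \<sigma> i (slot q')" using eq[unfolded ii] by blast
        have "slot q = slot q'"
          using inj_onD[OF \<sigma>_inj[OF target(4)[OF J(1)]] \<sigma>\<sigma> slot[OF J(1)]] slot[OF J(2)] ii by simp
        have "q \<noteq> q'" using pp ip ip' ii by simp
        with \<open>slot q = slot q'\<close> obtain j j' t where q: "q = Inr (j, t)" "q' = Inr (j', t)"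
          by (cases q; cases q') (auto simp: slot_def)
        define g where "g = \<sigma> i (slot q) \<otimes> inv t"
        have c: "g \<in> carrier G" "j < m" "j' < m"
          using J q MS[OF target(4)[OF J(1)]] target(3)[OF J(1)] by (auto simp: J_def g_def)
        have mv: "mover p = g \<otimes> r j" "mover p' = g \<otimes> r j'"
          using \<open>slot q = slot q'\<close> q by (auto simp: ip ip' ii mover_def g_def)
        obtain u where u: "u \<in> U j" "y = \<phi> (g \<otimes> r j) u" using y(1) mv q by (auto simp: ip piece_def)
        obtain u' where u': "u' \<in> U j'" "y = \<phi> (g \<otimes> r j') u'" using y(2) mv q by (auto simp: ip' piece_def)
        have uX: "u \<in> X" "u' \<in> X"
          using openin_imp_subset[OF U[OF c(2)]] openin_imp_subset[OF U[OF c(3)]] u(1) u'(1) by auto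
        have "\<phi> (r j) u = \<phi> (inv g) y" using u(2) c r uX by (simp add: act_mult)
        also have "\<dots> = \<phi> (r j') u'" using u'(2) c r uX by (simp add: act_mult)
        finally have e: "\<phi> (r j) u = \<phi> (r j') u'" .
        have "\<phi> (r j) u \<in> \<phi> (r j) ` U j" using u(1) by (rule imageI)
        moreover have "\<phi> (r j) u \<in> \<phi> (r j') ` U j'" unfolding e using u'(1) by (rule imageI)
        ultimately have "j = j'" using disj c unfolding disjoint_family_on_def by auto
        then show False using \<open>q \<noteq> q'\<close> q by simp
      qed
    qed
  qed
qed

text \<open>The levels of a castle as a partition of most of the space into open sets of small diameter.  This plays the role of
zero-dimensionality.\<close>

lemma small_disjoint_cells:
  fixes \<rho> \<epsilon> :: real
  assumes pos: "\<rho> > 0" "\<epsilon> > 0"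
  obtains L :: "nat \<Rightarrow> 'c set" where
    "\<And>k. openin (top_of_set X) (L k)" "disjoint_family L"
    "\<And>k x y. x \<in> L k \<Longrightarrow> y \<in> L k \<Longrightarrow> dist x y < \<rho>" "density_le (X - (\<Union>k. L k)) \<epsilon>"
proof -
  obtain I :: "nat set" and S V where
    oc: "open_castle G X \<phi> I S V"
    and diam: "\<And>i s. i \<in> I \<Longrightarrow> s \<in> S i \<Longrightarrow> diameter (\<phi> s ` V i) < \<rho>"
    and dens: "density_le (X - (\<Union>i\<in>I. translates \<phi> (S i) (V i))) \<epsilon>"
    by (rule castle_with_small_remainder[OF finite.emptyI empty_subsetI zero_less_one pos]) (rule that)
  have I: "finite I" and S: "\<And>i. i \<in> I \<Longrightarrow> finite (S i)" "\<And>i. i \<in> I \<Longrightarrow> S i \<subseteq> carrier G"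
    and V: "\<And>i. i \<in> I \<Longrightarrow> openin (top_of_set X) (V i)"
    using oc by (auto simp: open_castle_def castle_def tower_def)
  define Q where "Q = (SIGMA i:I. S i)"
  have "finite Q" using I S by (auto simp: Q_def)
  then obtain h where h: "bij_betw h {0..<card Q} Q" using ex_bij_betw_nat_finite by blast
  define level where "level = (\<lambda>(i, s). \<phi> s ` V i)"
  define L where "L k = (if k < card Q then level (h k) else {})" for k
  have hQ: "h k \<in> Q" if "k < card Q" for k using bij_betw_apply[OF h] that by simp
  have level: "openin (top_of_set X) (level q)" "x \<in> level q \<Longrightarrow> y \<in> level q \<Longrightarrow> dist x y < \<rho>" if "q \<in> Q" for q x y
  proof -
    obtain i s where q: "q = (i, s)" "i \<in> I" "s \<in> S i" using \<open>q \<in> Q\<close> by (auto simp: Q_def)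
    have op: "openin (top_of_set X) (\<phi> s ` V i)" using q S(2)[OF q(2)] V openin_translate by blast
    then show "openin (top_of_set X) (level q)" by (simp add: q(1) level_def)
    assume "x \<in> level q" "y \<in> level q"
    then have xy: "x \<in> \<phi> s ` V i" "y \<in> \<phi> s ` V i" by (simp_all add: q(1) level_def)
    have "bounded (\<phi> s ` V i)"
      using compact_imp_bounded[OF compact_space] bounded_subset openin_imp_subset[OF op] by blast
    then have "dist x y \<le> diameter (\<phi> s ` V i)" using diameter_bounded_bound xy by blast
    then show "dist x y < \<rho>" using diam[OF q(2,3)] by simp
  qed
  show ?thesis
  proof (rule that)
    show "openin (top_of_set X) (L k)" for k using level(1)[OF hQ] by (simp add: L_def)
    show "dist x y < \<rho>" if "x \<in> L k" "y \<in> L k" for k x y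
      using that level(2)[OF hQ] by (auto simp: L_def split: if_splits)
    show "disjoint_family L"
      unfolding disjoint_family_on_def
    proof (intro ballI impI, rule ccontr)
      fix k l assume "k \<noteq> l" "L k \<inter> L l \<noteq> {}"
      then obtain y where y: "k < card Q" "l < card Q" "y \<in> level (h k)" "y \<in> level (h l)"
        by (auto simp: L_def split: if_splits)
      obtain i s where k: "h k = (i, s)" "i \<in> I" "s \<in> S i" using hQ[OF y(1)] by (auto simp: Q_def)
      obtain i' s' where l: "h l = (i', s')" "i' \<in> I" "s' \<in> S i'" using hQ[OF y(2)] by (auto simp: Q_def)
      have "castle G X \<phi> I S V" using oc by (simp add: open_castle_def)
      then have "i = i' \<and> s = s'"
        by (rule castle_levels_unique[of I S V i i' s s' y]) (use y k l in \<open>simp_all add: level_def\<close>)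
      then have "h k = h l" using k l by simp
      then show False using h y \<open>k \<noteq> l\<close> unfolding bij_betw_def inj_on_def by auto
    qed
    have "translates \<phi> (S i) (V i) \<subseteq> (\<Union>k. L k)" if "i \<in> I" for i
    proof
      fix x assume "x \<in> translates \<phi> (S i) (V i)"
      then obtain s where s: "s \<in> S i" "x \<in> \<phi> s ` V i" by (auto simp: translates_def)
      then have "(i, s) \<in> h ` {0..<card Q}" using h that unfolding bij_betw_def by (simp add: Q_def)
      then obtain k where k: "k < card Q" "h k = (i, s)" by auto
      then have "x \<in> L k" using s by (simp add: L_def level_def)
      then show "x \<in> (\<Union>k. L k)" by blast
    qed
    then show "density_le (X - (\<Union>k. L k)) \<epsilon>" by (intro density_le_mono[OF dens]) auto
  qed
qed

end

section \<open>Finite index: distinguishing cosets by colours\<close>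

text \<open>\<open>T\<close> is a finite set of representatives of the cosets of \<open>H\<close>, in the form \<open>t <# H\<close>.\<close>

locale finite_index_action = normal H G + compact_action G X \<phi>
  for G (structure) and H and X :: "'x::metric_space set" and \<phi> +
  fixes T :: "'a set"
  assumes transversal: "finite T" "T \<subseteq> carrier G" "\<And>g. g \<in> carrier G \<Longrightarrow> \<exists>!t. t \<in> T \<and> inv t \<otimes> g \<in> H"
    and free: "g \<in> carrier G \<Longrightarrow> x \<in> X \<Longrightarrow> \<phi> g x = x \<Longrightarrow> g = \<one>"
    and almost_finite_H: "almost_finite (G\<lparr>carrier := H\<rparr>) X \<phi>"
begin

lemma group_action_H: "group_action (G\<lparr>carrier := H\<rparr>) X \<phi>"
  by (rule induced_action[OF normal_imp_subgroup[OF normal_axioms]])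

sublocale H: almost_finite_action "G\<lparr>carrier := H\<rparr>" X \<phi>
proof -
  interpret GH: group "G\<lparr>carrier := H\<rparr>" by (rule subgroup_is_group[OF is_group])
  interpret AH: group_action "G\<lparr>carrier := H\<rparr>" X \<phi> by (rule group_action_H)
  show "almost_finite_action (G\<lparr>carrier := H\<rparr>) X \<phi>"
    by unfold_locales (use compact_space continuous_act almost_finite_H in \<open>auto\<close>)
qed

lemma inv_H [simp]: "h \<in> H \<Longrightarrow> inv\<^bsub>G\<lparr>carrier := H\<rparr>\<^esub> h = inv h"
  using m_inv_consistent normal_imp_subgroup normal_axioms by blast

lemma H_subset: "H \<subseteq> carrier G" by (rule subset)

text \<open>Densities are taken with respect to \<open>H\<close>, but translation by elements of \<open>G\<close> preserves them: conjugation by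
\<open>g\<close> maps \<open>H\<close> to itself and carries invariant sets to invariant sets.\<close>

lemma density_le_translate:
  assumes g: "g \<in> carrier G" and A: "A \<subseteq> X" "H.density_le A a"
  shows "H.density_le (\<phi> g ` A) a"
proof -
  obtain E and \<eta> :: real where E: "finite E" "E \<subseteq> H" "\<eta> > 0"
    and *: "\<And>F x. finite F \<Longrightarrow> F \<subseteq> H \<Longrightarrow> invariant_set (G\<lparr>carrier := H\<rparr>) E \<eta> F \<Longrightarrow> x \<in> X
        \<Longrightarrow> real (H.visits F A x) \<le> a * real (card F)"
    by (rule H.density_leE[OF A(2)]) (rule that; simp)
  define c where "c f = inv g \<otimes> f \<otimes> g" for f
  define d where "d f = g \<otimes> f \<otimes> inv g" for f
  have cH: "c f \<in> H" and dH: "d f \<in> H" if "f \<in> H" for f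
    using that g by (simp_all add: c_def d_def inv_op_closed1 inv_op_closed2)
  have cd: "c (d f) = f" "d (c f) = f" if "f \<in> H" for f
    using that g H_subset by (simp_all add: c_def d_def m_assoc subset_iff) 
      (simp_all add: m_assoc[symmetric] subset_iff)
  have d_mult: "d (u \<otimes> h) = d u \<otimes> d h" if "u \<in> H" "h \<in> H" for u h
  proof -
    have "u \<in> carrier G" "h \<in> carrier G" using that H_subset by auto
    then have "inv g \<otimes> (g \<otimes> (h \<otimes> inv g)) = h \<otimes> inv g" using g by (simp add: m_assoc[symmetric])
    then show ?thesis using \<open>u \<in> carrier G\<close> \<open>h \<in> carrier G\<close> g by (simp add: d_def m_assoc)
  qed
  have c_inj: "inj_on c H" by (rule inj_on_inverseI[of _ d]) (use cd in auto)
  show ?thesis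
  proof (rule H.density_leI[of "d ` E" \<eta>])
    fix F x assume "finite F" "F \<subseteq> carrier (G\<lparr>carrier := H\<rparr>)"
      "invariant_set (G\<lparr>carrier := H\<rparr>) (d ` E) \<eta> F" and x: "x \<in> X"
    then have F: "finite F" "F \<subseteq> H" "invariant_set (G\<lparr>carrier := H\<rparr>) (d ` E) \<eta> F" by simp_all
    have cF: "card (c ` F) = card F" by (rule card_image) (use c_inj F inj_on_subset in blast)
    have mem: "h \<in> c ` F \<longleftrightarrow> d h \<in> F" if "h \<in> H" for h
      using that cd F(2) dH by (metis image_iff subsetD)
    have "boundary (G\<lparr>carrier := H\<rparr>) E (c ` F) \<subseteq> c ` boundary (G\<lparr>carrier := H\<rparr>) (d ` E) F"
    proof
      fix h assume "h \<in> boundary (G\<lparr>carrier := H\<rparr>) E (c ` F)"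
      then obtain e e' where h: "h \<in> H" "e \<in> E" "e' \<in> E" "e \<otimes> h \<in> c ` F" "e' \<otimes> h \<in> H - c ` F"
        by (auto simp: boundary_iff)
      have eH: "e \<in> H" "e' \<in> H" using h E by auto
      have "d e \<otimes> d h \<in> F" using h(4) mem[of "e \<otimes> h"] d_mult[OF eH(1) h(1)] eH h(1) by simp
      moreover have "d e' \<otimes> d h \<in> H - F"
        using h(5) mem[of "e' \<otimes> h"] d_mult[OF eH(2) h(1)] eH h(1) dH by simp
      ultimately have "d h \<in> boundary (G\<lparr>carrier := H\<rparr>) (d ` E) F"
        using h dH[OF h(1)] by (auto simp: boundary_iff)
      then have "c (d h) \<in> c ` boundary (G\<lparr>carrier := H\<rparr>) (d ` E) F" by (rule imageI)
      then show "h \<in> c ` boundary (G\<lparr>carrier := H\<rparr>) (d ` E) F" using cd h(1) by simp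
    qed
    moreover have fb: "finite (boundary (G\<lparr>carrier := H\<rparr>) (d ` E) F)"
      by (rule H.finite_boundary) (use E F dH in auto)
    ultimately have "card (boundary (G\<lparr>carrier := H\<rparr>) E (c ` F)) \<le> card (boundary (G\<lparr>carrier := H\<rparr>) (d ` E) F)"
      by (meson card_image_le card_mono finite_imageI le_trans)
    then have inv: "invariant_set (G\<lparr>carrier := H\<rparr>) E \<eta> (c ` F)"
      using F(3) unfolding invariant_set_def cF by (meson of_nat_mono order_trans)
    have gx: "\<phi> (inv g) x \<in> X" using g x by simp
    have vis: "\<phi> f x \<in> \<phi> g ` A \<longleftrightarrow> \<phi> (c f) (\<phi> (inv g) x) \<in> A" if "f \<in> F" for f
    proof -
      have f: "f \<in> carrier G" using that F H_subset by auto
      then have "\<phi> (c f) (\<phi> (inv g) x) = \<phi> (inv g) (\<phi> f x)" using g x by (simp add: c_def act_mult)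
      then show ?thesis using mem_translate_iff[OF g _ A(1), of "\<phi> f x"] f x by simp
    qed
    have "{f \<in> c ` F. \<phi> f (\<phi> (inv g) x) \<in> A} = c ` {f\<in>F. \<phi> f x \<in> \<phi> g ` A}" using vis by auto
    then have "H.visits (c ` F) A (\<phi> (inv g) x) = card (c ` {f\<in>F. \<phi> f x \<in> \<phi> g ` A})"
      by (simp add: H.visits_def)
    also have "\<dots> = H.visits F (\<phi> g ` A) x" unfolding H.visits_def
      by (rule card_image) (use c_inj F in \<open>auto intro: inj_on_subset\<close>)
    finally have "H.visits F (\<phi> g ` A) x = H.visits (c ` F) A (\<phi> (inv g) x)" by simp
    then show "real (H.visits F (\<phi> g ` A) x) \<le> a * real (card F)"
      using *[of "c ` F", OF _ _ inv gx] F cH cF by auto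
  qed (use E dH in auto)
qed

lemma points_move_apart:
  assumes "finite Q" "Q \<subseteq> carrier G" "\<one> \<notin> Q"
  obtains \<rho> :: real where "\<rho> > 0" "\<And>q x. q \<in> Q \<Longrightarrow> x \<in> X \<Longrightarrow> \<rho> \<le> dist (\<phi> q x) x"
proof -
  have "\<exists>\<rho>>0. \<forall>x\<in>X. \<rho> \<le> dist (\<phi> q x) x" if q: "q \<in> Q" for q
  proof (cases "X = {}")
    case False
    have "continuous_on X (\<lambda>x. dist (\<phi> q x) x)"
      by (intro continuous_intros continuous_act) (use q assms in auto)
    then obtain x0 where x0: "x0 \<in> X" "\<forall>x\<in>X. dist (\<phi> q x0) x0 \<le> dist (\<phi> q x) x"
      using continuous_attains_inf[OF compact_space False] by blast
    have "\<phi> q x0 \<noteq> x0" using free[of q x0] q x0 assms by auto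
    then show ?thesis using x0 by (intro exI[of _ "dist (\<phi> q x0) x0"]) auto
  qed (auto intro: exI[of _ 1])
  then obtain r where r: "\<And>q. q \<in> Q \<Longrightarrow> r q > 0 \<and> (\<forall>x\<in>X. r q \<le> dist (\<phi> q x) x)" by metis
  define \<rho> where "\<rho> = Min (insert 1 (r ` Q))"
  have "\<rho> > 0" unfolding \<rho>_def using assms r by (subst Min_gr_iff) auto
  moreover have "\<rho> \<le> dist (\<phi> q x) x" if "q \<in> Q" "x \<in> X" for q x
  proof -
    have "\<rho> \<le> r q" unfolding \<rho>_def using assms that by (intro Min_le) auto
    then show ?thesis using r[OF that(1)] that(2) by fastforce
  qed
  ultimately show ?thesis by (rule that)
qed

text \<open>The sets \<open>Z c\<close> are the colour classes of a colouring of most of \<open>X\<close> by natural numbers.  On the set \<open>N\<close> of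
low-density complement the colour is unchanged by \<open>E \<subseteq> H\<close>, while each \<open>p \<in> P\<close>, a set disjoint from
\<open>H\<close>, always changes it.

A castle for \<open>H\<close> tiles the orbits by large tiles; the colour of a point is determined by the tower \<open>i\<close>
and the cell \<open>L k\<close>, of small diameter, that contains the base point of its tile.  Hence points of one tile have
the same colour, and \<open>N\<close> consists of the points in the interior of their tile.  If \<open>x = s v\<close> and
\<open>p x = s' v'\<close> had the same colour, then \<open>v\<close> and \<open>v' = (s'\<inverse> p s) v\<close> would lie in one small cell; but
\<open>s'\<inverse> p s\<close> is not in \<open>H\<close>, so by freeness it moves every point by a definite distance.\<close>

lemma coloured_regions:
  fixes \<epsilon> :: real
  assumes E: "finite E" "E \<subseteq> H" and P: "finite P" "P \<subseteq> carrier G" "P \<inter> H = {}" and \<epsilon>: "\<epsilon> > 0"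
  obtains Z :: "nat \<Rightarrow> 'x set" and N where
    "\<And>c. openin (top_of_set X) (Z c)" "disjoint_family Z"
    "openin (top_of_set X) N" "N \<subseteq> (\<Union>c. Z c)" "H.density_le (X - N) \<epsilon>"
    "\<And>e x c. e \<in> E \<Longrightarrow> x \<in> N \<Longrightarrow> x \<in> Z c \<Longrightarrow> \<phi> e x \<in> Z c"
    "\<And>p x c. p \<in> P \<Longrightarrow> x \<in> Z c \<Longrightarrow> \<phi> p x \<notin> Z c"
proof -
  define K where "K = insert \<one> E"
  have K: "finite K" "K \<subseteq> carrier (G\<lparr>carrier := H\<rparr>)" "\<epsilon> / 4 > 0" using E \<epsilon> by (auto simp: K_def)
  obtain I :: "nat set" and S V where
    oc: "open_castle (G\<lparr>carrier := H\<rparr>) X \<phi> I S V"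
    and inv: "\<And>i. i \<in> I \<Longrightarrow> invariant_set (G\<lparr>carrier := H\<rparr>) K (\<epsilon> / 4) (S i)"
    and dens: "H.density_le (X - (\<Union>i\<in>I. translates \<phi> (S i) (V i))) (\<epsilon> / 4)"
    by (rule H.castle_with_small_remainder[OF K zero_less_one K(3)]) (rule that)
  have cas: "castle (G\<lparr>carrier := H\<rparr>) X \<phi> I S V" using oc by (simp add: open_castle_def)
  have I: "finite I" and S: "\<And>i. i \<in> I \<Longrightarrow> finite (S i)" "\<And>i. i \<in> I \<Longrightarrow> S i \<subseteq> H"
    and V: "\<And>i. i \<in> I \<Longrightarrow> openin (top_of_set X) (V i)" "\<And>i. i \<in> I \<Longrightarrow> V i \<subseteq> X"
    using oc by (auto simp: open_castle_def castle_def tower_def)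
  have SG: "s \<in> carrier G" if "i \<in> I" "s \<in> S i" for i s using S(2)[OF that(1)] that(2) H_subset by auto
  \<comment> \<open>The elements that relate the base points of two tiles of one tower related by \<open>p\<close>.\<close>
  define Q where "Q = (\<Union>i\<in>I. (\<lambda>(s, p, s'). inv s' \<otimes> p \<otimes> s) ` (S i \<times> P \<times> S i))"
  have Q: "finite Q" "Q \<subseteq> carrier G"
    using I S P SG unfolding Q_def by (auto simp: subset_iff)
  have "\<one> \<notin> Q"
  proof
    assume "\<one> \<in> Q"
    then obtain i s p s' where q: "i \<in> I" "s \<in> S i" "p \<in> P" "s' \<in> S i" "\<one> = inv s' \<otimes> p \<otimes> s"
      by (auto simp: Q_def)
    have c: "s \<in> carrier G" "p \<in> carrier G" "s' \<in> carrier G" using q SG P by auto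
    have "s' \<otimes> inv s = s' \<otimes> (inv s' \<otimes> p \<otimes> s) \<otimes> inv s" using q(5) c by (metis r_one)
    also have "\<dots> = (s' \<otimes> inv s') \<otimes> p \<otimes> (s \<otimes> inv s)" using c by (simp only: m_assoc m_closed inv_closed)
    also have "\<dots> = p" using c by simp
    finally have "s' \<otimes> inv s = p" .
    moreover have "s' \<in> H" "s \<in> H" using S(2)[OF q(1)] q(2,4) by auto
    ultimately have "p \<in> H" using subgroup.m_closed[OF subgroup_axioms] subgroup.m_inv_closed[OF subgroup_axioms] by metis
    then show False using P(3) q(3) by auto
  qed
  then obtain \<rho> :: real where \<rho>: "\<rho> > 0" "\<And>q x. q \<in> Q \<Longrightarrow> x \<in> X \<Longrightarrow> \<rho> \<le> dist (\<phi> q x) x"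
    by (rule points_move_apart[OF Q]) (rule that)
  \<comment> \<open>The cells miss a set of base points, which affects whole tiles, so its density is multiplied by
    at most \<open>total\<close>.\<close>
  define total where "total = real (\<Sum>i\<in>I. card (S i))"
  have total: "total \<ge> 0" by (simp add: total_def sum_nonneg)
  have \<epsilon>': "\<epsilon> / (4 * (1 + total)) > 0" by (rule divide_pos_pos) (use \<epsilon> total in auto)
  obtain L :: "nat \<Rightarrow> 'x set" where
    L: "\<And>k. openin (top_of_set X) (L k)" "disjoint_family L"
    "\<And>k x y. x \<in> L k \<Longrightarrow> y \<in> L k \<Longrightarrow> dist x y < \<rho>" "H.density_le (X - (\<Union>k. L k)) (\<epsilon> / (4 * (1 + total)))"
    by (rule H.small_disjoint_cells[OF \<rho>(1) \<epsilon>']) (rule that)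
  define Sint where "Sint i = {s\<in>S i. \<forall>e\<in>K. e \<otimes> s \<in> S i}" for i
  define Z where "Z c = (case prod_decode c of (i, k) \<Rightarrow>
     if i \<in> I then translates \<phi> (S i) (V i \<inter> L k) else {})" for c
  define N where "N = (\<Union>i\<in>I. \<Union>k. translates \<phi> (Sint i) (V i \<inter> L k))"
  have in_Z: "x \<in> Z c \<longleftrightarrow> (\<exists>i k s v. c = prod_encode (i, k) \<and> i \<in> I \<and> s \<in> S i \<and> v \<in> V i \<and> v \<in> L k \<and> x = \<phi> s v)" for x c
  proof -
    obtain i0 k0 where "prod_decode c = (i0, k0)" by (cases "prod_decode c")
    then have c: "c = prod_encode (i0, k0)" by (metis prod_decode_inverse)
    have "x \<in> Z c \<longleftrightarrow> i0 \<in> I \<and> (\<exists>s\<in>S i0. \<exists>v\<in>V i0 \<inter> L k0. x = \<phi> s v)"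
      by (simp add: c Z_def translates_def image_iff)
    then show ?thesis unfolding c prod_encode_eq prod.inject by blast
  qed
  have VL: "openin (top_of_set X) (V i \<inter> L k)" if "i \<in> I" for i k using V(1)[OF that] L(1) by (rule openin_Int)
  have unique: "i = i' \<and> s = s' \<and> v = v'"
    if "i \<in> I" "i' \<in> I" "s \<in> S i" "s' \<in> S i'" "v \<in> V i" "v' \<in> V i'" "\<phi> s v = \<phi> s' v'" for i i' s s' v v'
  proof -
    have "i = i' \<and> s = s'"
      by (rule H.castle_levels_unique[OF cas that(1-4) imageI[OF that(5)]])
        (unfold that(7), rule imageI[OF that(6)])
    moreover have "v \<in> X" "v' \<in> X" using that V(2) by auto
    ultimately show ?thesis using inj_onD[OF inj_prop[OF SG[OF that(1,3)]], of v v'] that(7) by simp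
  qed
  show ?thesis
  proof (rule that[of Z N])
    show "openin (top_of_set X) (Z c)" for c
    proof -
      obtain i k where c: "prod_decode c = (i, k)" by (cases "prod_decode c")
      have "openin (top_of_set X) (translates \<phi> (S i) (V i \<inter> L k))" if "i \<in> I"
        by (rule openin_translates[OF _ VL[OF that]]) (use SG that in auto)
      then show ?thesis by (simp add: Z_def c)
    qed
    show "disjoint_family Z"
      unfolding disjoint_family_on_def
    proof (intro ballI impI, rule ccontr)
      fix c c' assume "c \<noteq> c'" "Z c \<inter> Z c' \<noteq> {}"
      then obtain x where x: "x \<in> Z c" "x \<in> Z c'" by blast
      obtain i k s v where 1: "c = prod_encode (i, k)" "i \<in> I" "s \<in> S i" "v \<in> V i" "v \<in> L k" "x = \<phi> s v"
        using x(1) unfolding in_Z by blast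
      obtain i' k' s' v' where 2: "c' = prod_encode (i', k')" "i' \<in> I" "s' \<in> S i'" "v' \<in> V i'" "v' \<in> L k'" "x = \<phi> s' v'"
        using x(2) unfolding in_Z by blast
      have eq: "i = i' \<and> s = s' \<and> v = v'" using unique[OF 1(2) 2(2) 1(3) 2(3) 1(4) 2(4)] 1(6) 2(6) by simp
      then have "k = k'" using L(2) 1(5) 2(5) unfolding disjoint_family_on_def by blast
      then show False using eq 1 2 \<open>c \<noteq> c'\<close> by simp
    qed
    have Sint: "Sint i \<subseteq> S i" for i by (auto simp: Sint_def)
    have "openin (top_of_set X) (translates \<phi> (Sint i) (V i \<inter> L k))" if "i \<in> I" for i k
      by (rule openin_translates[OF _ VL[OF that]]) (use SG that Sint in auto)
    then show "openin (top_of_set X) N" unfolding N_def by (intro openin_Union) auto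
    show "N \<subseteq> (\<Union>c. Z c)"
    proof
      fix x assume "x \<in> N"
      then obtain i k s v where "i \<in> I" "s \<in> Sint i" "v \<in> V i" "v \<in> L k" "x = \<phi> s v"
        unfolding N_def translates_def by blast
      then have "x \<in> Z (prod_encode (i, k))" unfolding in_Z using Sint by blast
      then show "x \<in> (\<Union>c. Z c)" by blast
    qed
    show "\<phi> e x \<in> Z c" if e: "e \<in> E" and x: "x \<in> N" "x \<in> Z c" for e x c
    proof -
      obtain i k s v where 1: "c = prod_encode (i, k)" "i \<in> I" "s \<in> S i" "v \<in> V i" "v \<in> L k" "x = \<phi> s v"
        using x(2) unfolding in_Z by blast
      obtain i' s' v' where 2: "i' \<in> I" "s' \<in> Sint i'" "v' \<in> V i'" "x = \<phi> s' v'"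
        using x(1) unfolding N_def translates_def by blast
      have s': "s' \<in> S i'" using 2(2) Sint by blast
      have "\<phi> s v = \<phi> s' v'" using 1(6) 2(4) by simp
      then have "i = i' \<and> s = s' \<and> v = v'" by (rule unique[OF 1(2) 2(1) 1(3) s' 1(4) 2(3)])
      then have "e \<otimes> s \<in> S i" using 2(2) e by (auto simp: Sint_def K_def)
      moreover have "e \<in> carrier G" "v \<in> X" using e E H_subset V(2)[OF 1(2)] 1(4) by blast+
      then have "\<phi> e x = \<phi> (e \<otimes> s) v"
        using act_mult[of e s v] SG[OF 1(2,3)] 1(6) by simp
      ultimately show ?thesis unfolding in_Z using 1 by blast
    qed
    show "\<phi> p x \<notin> Z c" if p: "p \<in> P" and x: "x \<in> Z c" for p x c
    proof
      assume px: "\<phi> p x \<in> Z c"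
      obtain i k s v where 1: "c = prod_encode (i, k)" "i \<in> I" "s \<in> S i" "v \<in> V i" "v \<in> L k" "x = \<phi> s v"
        using x unfolding in_Z by blast
      obtain i' k' s' v' where 2: "c = prod_encode (i', k')" "i' \<in> I" "s' \<in> S i'" "v' \<in> V i'" "v' \<in> L k'" "\<phi> p x = \<phi> s' v'"
        using px unfolding in_Z by blast
      have ik: "i' = i" "k' = k" using 1(1) 2(1) by auto
      have c: "s \<in> carrier G" "s' \<in> carrier G" "p \<in> carrier G" "v \<in> X" "v' \<in> X"
        using 1 2 SG V(2) P p by auto
      have "\<phi> (inv s' \<otimes> p \<otimes> s) v = \<phi> (inv s') (\<phi> p x)" using c 1(6) by (simp add: act_mult)
      also have "\<dots> = v'" using 2(6) c by simp
      finally have v': "\<phi> (inv s' \<otimes> p \<otimes> s) v = v'" .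
      have "inv s' \<otimes> p \<otimes> s \<in> Q" using 1 2 ik p unfolding Q_def by force
      then have "\<rho> \<le> dist v' v" using \<rho>(2)[of "inv s' \<otimes> p \<otimes> s" v] c v' by simp
      then show False using L(3)[of v' k v] 1(5) 2(5) ik by simp
    qed
    show "H.density_le (X - N) \<epsilon>"
    proof -
      let ?R1 = "X - (\<Union>i\<in>I. translates \<phi> (S i) (V i))"
      let ?B = "\<Union>i\<in>I. translates \<phi> (S i - Sint i) (V i)"
      let ?R2 = "\<Union>(i, s)\<in>(SIGMA i:I. S i). \<phi> s ` (X - (\<Union>k. L k))"
      have small: "real (card (S i - Sint i)) \<le> \<epsilon> / 4 * real (card (S i))" if i: "i \<in> I" for i
      proof -
        have "real (card {s\<in>S i. \<exists>e\<in>K. e \<otimes>\<^bsub>G\<lparr>carrier := H\<rparr>\<^esub> s \<notin> S i}) \<le> \<epsilon> / 4 * real (card (S i))"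
          by (rule H.card_escaping_le[OF K(1) S(1)[OF i] K(2) _ _ inv[OF i]]) (use S(2)[OF i] in \<open>auto simp: K_def\<close>)
        moreover have "S i - Sint i = {s\<in>S i. \<exists>e\<in>K. e \<otimes> s \<notin> S i}" by (auto simp: Sint_def)
        ultimately show ?thesis by simp
      qed
      have B: "H.density_le ?B (\<epsilon> / 4 + \<epsilon> / 4)"
        by (rule H.density_le_subtowers[OF cas _ small]) (use \<epsilon> in auto)
      have fin: "finite (SIGMA i:I. S i)" using I S by auto
      have "H.density_le (\<phi> s ` (X - (\<Union>k. L k))) (\<epsilon> / (4 * (1 + total)))" if "s \<in> carrier G" for s
        by (rule density_le_translate[OF that _ L(4)]) auto
      then have "H.density_le ?R2 (\<Sum>(i, s)\<in>(SIGMA i:I. S i). \<epsilon> / (4 * (1 + total)))"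
        using SG by (intro H.density_le_UN[OF fin, of "\<lambda>(i, s). \<phi> s ` (X - (\<Union>k. L k))"
            "\<lambda>(i, s). \<epsilon> / (4 * (1 + total))"]) auto
      moreover have "(\<Sum>(i, s)\<in>(SIGMA i:I. S i). \<epsilon> / (4 * (1 + total))) = total * (\<epsilon> / (4 * (1 + total)))"
        using I S by (simp add: total_def split_def)
      moreover have "total * (\<epsilon> / (4 * (1 + total))) \<le> \<epsilon> / 4"
      proof -
        have "total * (\<epsilon> / (4 * (1 + total))) = (\<epsilon> / 4) * (total / (1 + total))" by simp
        also have "\<dots> \<le> (\<epsilon> / 4) * 1" using \<epsilon> total by (intro mult_left_mono) auto
        finally show ?thesis by simp
      qed
      ultimately have R2: "H.density_le ?R2 (\<epsilon> / 4)" using H.density_le_mono[OF _ Int_lower1] by metis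
      have "X - N \<subseteq> ?R1 \<union> ?B \<union> ?R2"
      proof
        fix x assume x: "x \<in> X - N"
        show "x \<in> ?R1 \<union> ?B \<union> ?R2"
        proof (cases "x \<in> ?R1")
          case False
          then obtain i s v where s: "i \<in> I" "s \<in> S i" "v \<in> V i" "x = \<phi> s v"
            using x unfolding translates_def by blast
          then have "v \<in> X" using V(2) by blast
          show ?thesis
          proof (cases "s \<in> Sint i \<and> v \<in> (\<Union>k. L k)")
            case True
            then have "x \<in> N" using s unfolding N_def translates_def by blast
            then show ?thesis using x by simp
          next
            case False
            then consider "s \<in> S i - Sint i" | "v \<in> X - (\<Union>k. L k)" using s \<open>v \<in> X\<close> by blast
            then show ?thesis
            proof cases
              case 1
              then have "x \<in> ?B" using s unfolding translates_def by blast
              then show ?thesis by blast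
            next
              case 2
              then have "x \<in> \<phi> s ` (X - (\<Union>k. L k))" using s(4) by blast
              then have "x \<in> ?R2" using s by blast
              then show ?thesis by blast
            qed
          qed
        qed blast
      qed
      then have sub: "(X - N) \<inter> X \<subseteq> ?R1 \<union> ?B \<union> ?R2" by blast
      show ?thesis
        by (rule H.density_le_mono[OF H.density_le_Un[OF H.density_le_Un[OF dens B] R2] sub]) simp
    qed
  qed
qed

end

section \<open>An approximate fundamental domain\<close>

context finite_index_action
begin

lemma transversal_unique:
  assumes "t \<in> T" "t' \<in> T" "inv t \<otimes> t' \<in> H"
  shows "t = t'"
proof -
  have c: "t \<in> carrier G" "t' \<in> carrier G" using assms transversal(2) by auto
  have "inv t' \<otimes> t' \<in> H" using c subgroup.one_closed[OF subgroup_axioms] by simp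
  then show ?thesis using transversal(3)[OF c(2)] assms by blast
qed

text \<open>As \<open>T\<close> represents the left cosets, the inverses of its elements represent the right cosets.\<close>

lemma right_transversal:
  assumes "g \<in> carrier G"
  obtains t where "t \<in> T" "g \<otimes> t \<in> H"
proof -
  obtain t where t: "t \<in> T" "inv t \<otimes> inv g \<in> H" using transversal(3)[of "inv g"] assms by blast
  have c: "t \<in> carrier G" using t transversal by auto
  have "inv (inv t \<otimes> inv g) \<in> H" by (rule subgroup.m_inv_closed[OF subgroup_axioms t(2)])
  then have "g \<otimes> t \<in> H" using c assms by (simp add: inv_mult_group)
  then show ?thesis using that t by blast
qed

text \<open>The colouring breaks the symmetry between the cosets.  At most points \<open>x\<close> the colour of
\<open>p x\<close>, for the finitely many \<open>p\<close> that matter, depends only on the coset of \<open>p\<close>, and different cosets have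
different colours; let \<open>Y\<close> be the set of points whose own coset
has the least colour.  On each orbit this singles out one coset locally, so the translates of \<open>Y\<close> by \<open>T\<close> are
disjoint and cover most of the space.  Since elements of \<open>E\<close> do not change the colours at typical
points, \<open>Y\<close> is nearly invariant under \<open>E\<close>.  It cannot be invariant in general, as \<open>H\<close> may act minimally.\<close>

lemma approximate_fundamental_domain:
  fixes \<epsilon> :: real
  assumes E: "finite E" "E \<subseteq> H" and \<epsilon>: "\<epsilon> > 0"
  obtains Y Bad where "openin (top_of_set X) Y"
    "\<And>t t'. t \<in> T \<Longrightarrow> t' \<in> T \<Longrightarrow> t \<noteq> t' \<Longrightarrow> \<phi> t ` Y \<inter> \<phi> t' ` Y = {}"
    "H.density_le Bad \<epsilon>" "Bad \<subseteq> X"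
    "\<And>x. x \<in> X \<Longrightarrow> x \<notin> Bad \<Longrightarrow> \<exists>t\<in>T. x \<in> \<phi> t ` Y"
    "\<And>x e. x \<in> Y \<Longrightarrow> x \<notin> Bad \<Longrightarrow> e \<in> E \<Longrightarrow> \<phi> e x \<in> Y"
proof -
  have TG: "t \<in> carrier G" if "t \<in> T" for t using that transversal(2) by auto
  have EG: "e \<in> carrier G" if "e \<in> E" for e using that E H_subset by auto
  \<comment> \<open>Quotients of two representatives detect overlaps of the translates of \<open>Y\<close>.\<close>
  define P where "P = insert \<one> ((\<lambda>(t, t'). inv t \<otimes> t') ` (T \<times> T))"
  have P: "finite P" "P \<subseteq> carrier G" "\<one> \<in> P" using transversal(1) TG by (auto simp: P_def)
  have PG: "p \<in> carrier G" if "p \<in> P" for p using that P by auto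
  \<comment> \<open>Elements of \<open>H\<close> under which colours have to persist: \<open>p e = (p e p\<inverse>) p\<close> is used for near
    invariance, and \<open>p t\<inverse> = h t'\<inverse>\<close> for covering.\<close>
  define E' where "E' = (\<lambda>(p, e). p \<otimes> e \<otimes> inv p) ` (P \<times> E) \<union>
      H \<inter> (\<lambda>(p, t, t'). p \<otimes> inv t \<otimes> t') ` (P \<times> T \<times> T)"
  have "(\<lambda>(p, e). p \<otimes> e \<otimes> inv p) ` (P \<times> E) \<subseteq> H"
    using E PG inv_op_closed2 by auto
  then have E': "finite E'" "E' \<subseteq> H"
    unfolding E'_def using P(1) E(1) transversal(1) by auto
  \<comment> \<open>A point outside \<open>Bad\<close> has all colours that are compared below well-defined and stable.\<close>
  define P1 where "P1 = P \<union> (\<lambda>(p, e). p \<otimes> e) ` (P \<times> E) \<union> (\<lambda>(p, t). p \<otimes> inv t) ` (P \<times> T)"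
  have P1: "finite P1" "P1 \<subseteq> carrier G"
    unfolding P1_def using P(1) E(1) transversal(1) PG EG TG by auto
  define \<epsilon>' where "\<epsilon>' = \<epsilon> / (1 + real (card P1))"
  have \<epsilon>': "\<epsilon>' > 0" unfolding \<epsilon>'_def using \<epsilon> by (intro divide_pos_pos) auto
  have PH: "finite (P - H)" "P - H \<subseteq> carrier G" "(P - H) \<inter> H = {}" using P by auto
  obtain Z :: "nat \<Rightarrow> 'x set" and N where
    Z: "\<And>c. openin (top_of_set X) (Z c)" "disjoint_family Z"
    and N: "openin (top_of_set X) N" "N \<subseteq> (\<Union>c. Z c)" "H.density_le (X - N) \<epsilon>'"
    and keep: "\<And>e x c. e \<in> E' \<Longrightarrow> x \<in> N \<Longrightarrow> x \<in> Z c \<Longrightarrow> \<phi> e x \<in> Z c"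
    and change: "\<And>p x c. p \<in> P - H \<Longrightarrow> x \<in> Z c \<Longrightarrow> \<phi> p x \<notin> Z c"
    by (rule coloured_regions[OF E' PH \<epsilon>']) (rule that)
  define col where "col x = (THE c. x \<in> Z c)" for x
  have col: "col x = c" if "x \<in> Z c" for x c
    unfolding col_def using that Z(2) by (intro the_equality) (auto simp: disjoint_family_on_def)
  have N_col: "x \<in> Z (col x)" if "x \<in> N" for x
  proof -
    obtain c where "x \<in> Z c" using N(2) \<open>x \<in> N\<close> by blast
    then show ?thesis using col by simp
  qed
  have col_keep: "col (\<phi> e x) = col x" if "e \<in> E'" "x \<in> N" for e x
    by (rule col[OF keep[OF that N_col[OF that(2)]]])
  define Y where "Y = {x\<in>X. \<forall>p\<in>P. \<phi> p x \<in> N \<and> (p \<notin> H \<longrightarrow> col x < col (\<phi> p x))}"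
  define Bad where "Bad = {x\<in>X. \<exists>p\<in>P1. \<phi> p x \<notin> N}"
  have PP1: "P \<subseteq> P1" by (auto simp: P1_def)
  show ?thesis
  proof (rule that[of Y Bad])
    show "openin (top_of_set X) Y"
    proof (subst openin_subopen, intro ballI)
      fix x assume x: "x \<in> Y"
      define W where "W = (\<Inter>p\<in>P. X \<inter> \<phi> p -` (N \<inter> Z (col (\<phi> p x))))"
      have "openin (top_of_set X) W"
        unfolding W_def
      proof (rule openin_Inter)
        fix A assume "A \<in> (\<lambda>p. X \<inter> \<phi> p -` (N \<inter> Z (col (\<phi> p x)))) ` P"
        then obtain p where p: "p \<in> P" "A = X \<inter> \<phi> p -` (N \<inter> Z (col (\<phi> p x)))" by blast
        have "openin (top_of_set X) (N \<inter> Z (col (\<phi> p x)))" using N(1) Z(1) by (rule openin_Int)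
        then show "openin (top_of_set X) A" unfolding p(2)
          by (rule continuous_openin_preimage[OF continuous_act[OF PG[OF p(1)]], rotated])
            (use PG[OF p(1)] in auto)
      qed (use P in auto)
      moreover have "x \<in> W" using x N_col by (auto simp: W_def Y_def)
      moreover have "W \<subseteq> Y"
      proof
        fix y assume y: "y \<in> W"
        have yX: "y \<in> X" using y P(3) unfolding W_def by blast
        have xX: "x \<in> X" using x by (simp add: Y_def)
        have yp: "\<phi> p y \<in> N" "col (\<phi> p y) = col (\<phi> p x)" if "p \<in> P" for p
        proof -
          have yp: "\<phi> p y \<in> N \<inter> Z (col (\<phi> p x))" using y that unfolding W_def by blast
          then show "\<phi> p y \<in> N" by (rule IntD1)
          show "col (\<phi> p y) = col (\<phi> p x)" by (rule col[OF IntD2[OF yp]])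
        qed
        have "col y = col x" using yp(2)[OF P(3)] xX yX by simp
        then show "y \<in> Y" using yX yp x by (auto simp: Y_def)
      qed
      ultimately show "\<exists>W. openin (top_of_set X) W \<and> x \<in> W \<and> W \<subseteq> Y" by blast
    qed
    show "\<phi> t ` Y \<inter> \<phi> t' ` Y = {}" if t: "t \<in> T" "t' \<in> T" "t \<noteq> t'" for t t'
    proof (rule ccontr)
      assume "\<not> ?thesis"
      then obtain y y' where y: "y \<in> Y" "y' \<in> Y" "\<phi> t y = \<phi> t' y'" by blast
      have X: "y \<in> X" "y' \<in> X" using y by (auto simp: Y_def)
      have P': "inv t \<otimes> t' \<in> P" "inv t' \<otimes> t \<in> P" using t by (auto simp: P_def)
      have nH: "inv t \<otimes> t' \<notin> H" "inv t' \<otimes> t \<notin> H" using transversal_unique t by blast+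
      have "\<phi> (inv t \<otimes> t') y' = y" using y(3)[symmetric] t TG X by (simp add: act_mult)
      then have "col y' < col y" using y(2) P'(1) nH(1) by (force simp: Y_def)
      moreover have "\<phi> (inv t' \<otimes> t) y = y'" using y(3) t TG X by (simp add: act_mult)
      then have "col y < col y'" using y(1) P'(2) nH(2) by (force simp: Y_def)
      ultimately show False by simp
    qed
    show "H.density_le Bad \<epsilon>"
    proof -
      have "H.density_le (\<Union>p\<in>P1. \<phi> (inv p) ` (X - N)) (\<Sum>p\<in>P1. \<epsilon>')"
        by (intro H.density_le_UN P1 density_le_translate) (use P1 N in auto)
      moreover have "Bad \<inter> X \<subseteq> (\<Union>p\<in>P1. \<phi> (inv p) ` (X - N))"
      proof
        fix x assume "x \<in> Bad \<inter> X"
        then obtain p where p: "x \<in> X" "p \<in> P1" "\<phi> p x \<notin> N" by (auto simp: Bad_def)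
        then have "p \<in> carrier G" using P1 by auto
        then have "x = \<phi> (inv p) (\<phi> p x)" "\<phi> p x \<in> X - N" using p by auto
        then show "x \<in> (\<Union>p\<in>P1. \<phi> (inv p) ` (X - N))" using p(2) by blast
      qed
      moreover have "(\<Sum>p\<in>P1. \<epsilon>') \<le> \<epsilon>"
      proof -
        have "(\<Sum>p\<in>P1. \<epsilon>') = \<epsilon> * (real (card P1) / (1 + real (card P1)))" by (simp add: \<epsilon>'_def)
        also have "\<dots> \<le> \<epsilon> * 1" using \<epsilon> by (intro mult_left_mono) auto
        finally show ?thesis by simp
      qed
      ultimately show ?thesis by (rule H.density_le_mono)
    qed
    show "Bad \<subseteq> X" by (auto simp: Bad_def)
    show "\<exists>t\<in>T. x \<in> \<phi> t ` Y" if x: "x \<in> X" "x \<notin> Bad" for x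
    proof -
      have good: "\<phi> p x \<in> N" if "p \<in> P1" for p using x that by (auto simp: Bad_def)
      have T_ne: "T \<noteq> {}" using transversal(3)[OF one_closed] by blast
      \<comment> \<open>The coset with the least colour decides which translate of \<open>Y\<close> contains \<open>x\<close>.\<close>
      obtain t where t: "t \<in> T" "\<And>t'. t' \<in> T \<Longrightarrow> col (\<phi> (inv t) x) \<le> col (\<phi> (inv t') x)"
        using arg_min_if_finite(1)[OF transversal(1) T_ne] arg_min_least[OF transversal(1) T_ne]
        by (rule that[of "arg_min_on (\<lambda>t. col (\<phi> (inv t) x)) T"])
      have tG: "t \<in> carrier G" using TG t(1) .
      define y where "y = \<phi> (inv t) x"
      have y: "y \<in> X" "x = \<phi> t y" using x tG by (auto simp: y_def)
      have inN: "\<phi> (inv t') x \<in> N" if "t' \<in> T" for t'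
      proof -
        have "\<one> \<otimes> inv t' \<in> P1" using P(3) that unfolding P1_def by force
        then show ?thesis using good TG[OF that] by simp
      qed
      have "\<phi> p y \<in> N \<and> (p \<notin> H \<longrightarrow> col y < col (\<phi> p y))" if p: "p \<in> P" for p
      proof
        have pG: "p \<in> carrier G" using PG p .
        have py: "\<phi> p y = \<phi> (p \<otimes> inv t) x" using pG tG x by (simp add: y_def act_mult)
        have "p \<otimes> inv t \<in> P1" using p t(1) unfolding P1_def by force
        then show N': "\<phi> p y \<in> N" using good py by simp
        show "p \<notin> H \<longrightarrow> col y < col (\<phi> p y)"
        proof
          assume "p \<notin> H"
          have "p \<otimes> inv t \<in> carrier G" using pG tG by simp
          then obtain t' where t': "t' \<in> T" "p \<otimes> inv t \<otimes> t' \<in> H" by (rule right_transversal)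
          have t'G: "t' \<in> carrier G" using TG t'(1) .
          have h: "p \<otimes> inv t \<otimes> t' \<in> E'" using t' t(1) p unfolding E'_def by force
          have "\<phi> p y = \<phi> (p \<otimes> inv t \<otimes> t') (\<phi> (inv t') x)"
            using pG tG t'G x by (simp add: y_def act_mult)
          then have "col (\<phi> p y) = col (\<phi> (inv t') x)" using col_keep[OF h inN[OF t'(1)]] by simp
          then have "col y \<le> col (\<phi> p y)" using t(2)[OF t'(1)] by (simp add: y_def)
          moreover have "y \<in> Z (col y)" using N_col[OF inN[OF t(1)]] by (simp add: y_def)
          then have "\<phi> p y \<notin> Z (col y)" using change[of p y] p \<open>p \<notin> H\<close> by simp
          then have "col y \<noteq> col (\<phi> p y)" using N_col[OF N'] by auto
          ultimately show "col y < col (\<phi> p y)" by simp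
        qed
      qed
      then have "y \<in> Y" using y(1) by (simp add: Y_def)
      then show ?thesis using t(1) y(2) by blast
    qed
    show "\<phi> e x \<in> Y" if x: "x \<in> Y" "x \<notin> Bad" and e: "e \<in> E" for x e
    proof -
      have xX: "x \<in> X" using x(1) by (simp add: Y_def)
      have good: "\<phi> p x \<in> N" if "p \<in> P1" for p using x(2) xX that by (auto simp: Bad_def)
      have eG: "e \<in> carrier G" using EG e .
      have *: "\<phi> p (\<phi> e x) \<in> N \<and> col (\<phi> p (\<phi> e x)) = col (\<phi> p x)" if p: "p \<in> P" for p
      proof
        have pG: "p \<in> carrier G" using PG p .
        have "p \<otimes> e \<in> P1" using p e unfolding P1_def by force
        then show "\<phi> p (\<phi> e x) \<in> N" using good pG eG xX by (simp flip: act_mult)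
        have h: "p \<otimes> e \<otimes> inv p \<in> E'" using p e unfolding E'_def by force
        have "\<phi> p (\<phi> e x) = \<phi> (p \<otimes> e \<otimes> inv p) (\<phi> p x)" using pG eG xX by (simp add: act_mult)
        then show "col (\<phi> p (\<phi> e x)) = col (\<phi> p x)" using col_keep[OF h] good p PP1 by auto
      qed
      have "col (\<phi> e x) = col x" using *[OF P(3)] xX eG by simp
      then show ?thesis using * x(1) eG xX by (auto simp: Y_def)
    qed
  qed
qed

lemma transversal_mult_unique:
  assumes "t \<in> T" "t' \<in> T" "h \<in> H" "h' \<in> H" "t \<otimes> h = t' \<otimes> h'"
  shows "t = t' \<and> h = h'"
proof -
  have c: "t \<in> carrier G" "t' \<in> carrier G" "h \<in> carrier G" "h' \<in> carrier G"
    using assms transversal(2) H_subset by auto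
  have "inv t \<otimes> t' = inv t \<otimes> (t' \<otimes> h') \<otimes> inv h'" using c by (simp add: m_assoc)
  also have "\<dots> = inv t \<otimes> (t \<otimes> h) \<otimes> inv h'" using assms(5) by simp
  also have "\<dots> = h \<otimes> inv h'" using c by (simp add: m_assoc[symmetric])
  finally have "inv t \<otimes> t' = h \<otimes> inv h'" .
  then have "inv t \<otimes> t' \<in> H"
    using assms subgroup.m_closed[OF subgroup_axioms] subgroup.m_inv_closed[OF subgroup_axioms] by metis
  then have "t = t'" using transversal_unique assms by blast
  then show ?thesis using assms c by simp
qed

lemma card_transversal_mult:
  assumes "S \<subseteq> H"
  shows "card (T <#> S) = card T * card S"
proof -
  have "T <#> S = (\<lambda>(t, s). t \<otimes> s) ` (T \<times> S)" by (force simp: set_mult_def)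
  moreover have "inj_on (\<lambda>(t, s). t \<otimes> s) (T \<times> S)"
  proof (rule inj_onI, clarify)
    fix t s t' s' assume "t \<in> T" "t' \<in> T" "s \<in> S" "s' \<in> S" "t \<otimes> s = t' \<otimes> s'"
    then show "t = t' \<and> s = s'" using assms by (intro transversal_mult_unique) auto
  qed
  ultimately show ?thesis by (simp add: card_image card_cartesian_product)
qed

text \<open>Left multiplication by \<open>k\<close> permutes the cosets \<open>t <# H\<close> and
acts on their \<open>H\<close>-coordinates by elements of a finite set \<open>E \<subseteq> H\<close>.  So if \<open>t \<otimes> h\<close> is in the boundary of
\<open>T <#> S\<close>, then \<open>h\<close> is in the \<open>E\<close>-boundary of \<open>S\<close>, and the ratio of the cardinalities of the
boundary and the set does not increase.\<close>

lemma invariant_set_transversal_mult: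
  assumes K: "finite K" "K \<subseteq> carrier G"
  obtains E where "finite E" "E \<subseteq> H"
    "\<And>S \<delta>. finite S \<Longrightarrow> S \<subseteq> H \<Longrightarrow> invariant_set (G\<lparr>carrier := H\<rparr>) E \<delta> S \<Longrightarrow> invariant_set G K \<delta> (T <#> S)"
proof (rule that)
  define E where "E = H \<inter> (\<lambda>(t', k, t). inv t' \<otimes> (k \<otimes> t)) ` (T \<times> K \<times> T)"
  show E: "finite E" "E \<subseteq> H" using transversal(1) K by (auto simp: E_def)
  fix S and \<delta> :: real
  assume S: "finite S" "S \<subseteq> H" "invariant_set (G\<lparr>carrier := H\<rparr>) E \<delta> S"
  have fb: "finite (boundary (G\<lparr>carrier := H\<rparr>) E S)"
    by (rule H.finite_boundary) (use E S in auto)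
  have "boundary G K (T <#> S) \<subseteq> (\<lambda>(t, h). t \<otimes> h) ` (T \<times> boundary (G\<lparr>carrier := H\<rparr>) E S)"
  proof
    fix g assume "g \<in> boundary G K (T <#> S)"
    then obtain k k' where g: "g \<in> carrier G" "k \<in> K" "k' \<in> K" "k \<otimes> g \<in> T <#> S" "k' \<otimes> g \<notin> T <#> S"
      by (auto simp: boundary_iff)
    obtain t where t: "t \<in> T" "inv t \<otimes> g \<in> H" using transversal(3)[OF g(1)] by blast
    define h where "h = inv t \<otimes> g"
    have c: "t \<in> carrier G" "h \<in> carrier G" "k \<in> carrier G" "k' \<in> carrier G"
      using t transversal(2) H_subset g K by (auto simp: h_def)
    have gth: "g = t \<otimes> h" using c g(1) by (simp add: h_def m_assoc[symmetric])
    obtain u s where us: "u \<in> T" "s \<in> S" "k \<otimes> g = u \<otimes> s" using g(4) by (auto simp: set_mult_def)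
    have uc: "u \<in> carrier G" "s \<in> carrier G" "s \<in> H" using us transversal(2) H_subset S by auto
    have eh: "inv u \<otimes> (k \<otimes> t) \<otimes> h = s"
    proof -
      have "inv u \<otimes> (k \<otimes> t) \<otimes> h = inv u \<otimes> (k \<otimes> g)" using c uc by (simp add: gth m_assoc)
      also have "\<dots> = s" using uc by (simp add: us(3) m_assoc[symmetric])
      finally show ?thesis .
    qed
    then have "inv u \<otimes> (k \<otimes> t) = s \<otimes> inv h" using c uc by (simp add: inv_solve_right)
    then have "inv u \<otimes> (k \<otimes> t) \<in> H"
      using uc(3) t(2) subgroup.m_closed[OF subgroup_axioms] subgroup.m_inv_closed[OF subgroup_axioms]
      unfolding h_def by metis
    then have e: "inv u \<otimes> (k \<otimes> t) \<in> E" using us(1) g(2) t(1) unfolding E_def by force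
    obtain w where w: "w \<in> T" "inv w \<otimes> (k' \<otimes> t) \<in> H" using transversal(3)[of "k' \<otimes> t"] c by blast
    have wc: "w \<in> carrier G" using w transversal(2) by auto
    have e': "inv w \<otimes> (k' \<otimes> t) \<in> E" using w g(3) t(1) unfolding E_def by force
    have "k' \<otimes> g = w \<otimes> (inv w \<otimes> (k' \<otimes> t) \<otimes> h)" using c wc by (simp add: gth m_assoc[symmetric])
    then have "inv w \<otimes> (k' \<otimes> t) \<otimes> h \<notin> S" using g(5) w(1) by (auto simp: set_mult_def)
    moreover have "inv w \<otimes> (k' \<otimes> t) \<otimes> h \<in> H"
      using w(2) t(2) subgroup.m_closed[OF subgroup_axioms] unfolding h_def by blast
    ultimately have "h \<in> boundary (G\<lparr>carrier := H\<rparr>) E S"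
      using e e' eh us(2) t(2) unfolding boundary_iff h_def by auto
    then show "g \<in> (\<lambda>(t, h). t \<otimes> h) ` (T \<times> boundary (G\<lparr>carrier := H\<rparr>) E S)"
      using t(1) gth by force
  qed
  then have "card (boundary G K (T <#> S)) \<le> card ((\<lambda>(t, h). t \<otimes> h) ` (T \<times> boundary (G\<lparr>carrier := H\<rparr>) E S))"
    using fb transversal(1) by (intro card_mono) auto
  also have "\<dots> \<le> card (T \<times> boundary (G\<lparr>carrier := H\<rparr>) E S)"
    using fb transversal(1) by (intro card_image_le) auto
  finally have "card (boundary G K (T <#> S)) \<le> card T * card (boundary (G\<lparr>carrier := H\<rparr>) E S)"
    by (simp add: card_cartesian_product)
  then have "real (card (boundary G K (T <#> S))) \<le> real (card T) * real (card (boundary (G\<lparr>carrier := H\<rparr>) E S))"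
    by (metis of_nat_le_iff of_nat_mult)
  also have "\<dots> \<le> real (card T) * (\<delta> * real (card S))"
    using S(3) unfolding invariant_set_def by (intro mult_left_mono) auto
  finally show "invariant_set G K \<delta> (T <#> S)"
    unfolding invariant_set_def card_transversal_mult[OF S(2)] by (simp add: mult_ac)
qed

lemma small_translates_uniformly:
  fixes \<delta> :: real
  assumes "\<delta> > 0"
  obtains \<rho> :: real where "\<rho> > 0"
    "\<And>t A. t \<in> T \<Longrightarrow> A \<subseteq> X \<Longrightarrow> diameter A < \<rho> \<Longrightarrow> diameter (\<phi> t ` A) < \<delta>"
proof -
  have "\<exists>\<rho>>0. \<forall>x\<in>X. \<forall>y\<in>X. dist y x < \<rho> \<longrightarrow> dist (\<phi> t y) (\<phi> t x) < \<delta> / 2" if "t \<in> T" for t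
  proof -
    have "uniformly_continuous_on X (\<phi> t)"
      using compact_uniformly_continuous[OF continuous_act compact_space] that transversal(2) by blast
    then show ?thesis unfolding uniformly_continuous_on_def using assms half_gt_zero by blast
  qed
  then obtain r where r: "\<And>t. t \<in> T \<Longrightarrow> r t > 0 \<and> (\<forall>x\<in>X. \<forall>y\<in>X. dist y x < r t \<longrightarrow> dist (\<phi> t y) (\<phi> t x) < \<delta> / 2)"
    by metis
  define \<rho> where "\<rho> = Min (insert 1 (r ` T))"
  have "\<rho> > 0" unfolding \<rho>_def using transversal(1) r by (subst Min_gr_iff) auto
  moreover have "diameter (\<phi> t ` A) < \<delta>" if t: "t \<in> T" and A: "A \<subseteq> X" "diameter A < \<rho>" for t A
  proof -
    have \<rho>: "\<rho> \<le> r t" unfolding \<rho>_def using transversal(1) t by (intro Min_le) auto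
    have bA: "bounded A" using compact_imp_bounded[OF compact_space] A(1) bounded_subset by blast
    have *: "dist (\<phi> t y) (\<phi> t x) \<le> \<delta> / 2" if "x \<in> A" "y \<in> A" for x y
    proof -
      have "dist y x \<le> diameter A" using diameter_bounded_bound[OF bA] that by blast
      then have "dist y x < r t" using A(2) \<rho> by linarith
      then show ?thesis using r[OF t] that A(1) by (meson less_imp_le subsetD)
    qed
    have "diameter (\<phi> t ` A) \<le> \<delta> / 2"
    proof (cases "A = {}")
      case False
      then have "diameter (\<phi> t ` A) = (SUP (x, y)\<in>\<phi> t ` A \<times> \<phi> t ` A. dist x y)"
        by (simp add: diameter_def)
      also have "\<dots> \<le> \<delta> / 2" by (rule cSUP_least) (use False * in auto)
      finally show ?thesis .
    qed (use assms in \<open>simp add: diameter_def\<close>)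
    then show ?thesis using assms by linarith
  qed
  ultimately show ?thesis by (rule that)
qed

end

section \<open>Almost finiteness of the extension\<close>

context finite_index_action
begin

lemma subequivalent_from_H:
  assumes "openin (top_of_set X) B" and A: "H.density_le A a" "H.density_le (X - B) b" "a + b < 1"
  shows "subequivalent G X \<phi> A B"
  unfolding subequivalent_def
proof (intro allI impI)
  fix C assume C: "closedin (top_of_set X) C \<and> C \<subseteq> A"
  then have "H.density_le C a" by (intro H.density_le_mono[OF A(1)]) auto
  then obtain m :: nat and U s where *:
    "(\<forall>j<m. openin (top_of_set X) (U j) \<and> s j \<in> carrier (G\<lparr>carrier := H\<rparr>)) \<and>
      C \<subseteq> (\<Union>j<m. U j) \<and> disjoint_family_on (\<lambda>j. \<phi> (s j) ` U j) {..<m} \<and>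
      (\<forall>j<m. \<phi> (s j) ` U j \<subseteq> B)"
    using H.comparison[OF conjunct1[OF C] _ assms(1) A(2,3)] by (elim exE meta_impE)
  then show "\<exists>(m::nat) U s. (\<forall>j<m. openin (top_of_set X) (U j) \<and> s j \<in> carrier G) \<and>
      C \<subseteq> (\<Union>j<m. U j) \<and> disjoint_family_on (\<lambda>j. \<phi> (s j) ` U j) {..<m} \<and>
      (\<forall>j<m. \<phi> (s j) ` U j \<subseteq> B)"
    by (intro exI[of _ m] exI[of _ U] exI[of _ s]) (use H_subset in auto)
qed

text \<open>As a subset of itself \<open>H\<close> has empty boundary, so the density bound applies to the visits along the whole of
\<open>H\<close>; if it allows less than one visit, then there is none.\<close>

lemma finite_subgroup_small_density_empty:
  assumes "finite H" "H.density_le A a" "a * real (card H) < 1" "A \<subseteq> X"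
  shows "A = {}"
proof (rule ccontr)
  assume "A \<noteq> {}"
  then obtain x where x: "x \<in> A" "x \<in> X" using assms(4) by blast
  obtain E and \<eta> :: real where E: "finite E" "E \<subseteq> H" "\<eta> > 0"
    and *: "\<And>F x. finite F \<Longrightarrow> F \<subseteq> H \<Longrightarrow> invariant_set (G\<lparr>carrier := H\<rparr>) E \<eta> F \<Longrightarrow> x \<in> X
        \<Longrightarrow> real (H.visits F A x) \<le> a * real (card F)"
    by (rule H.density_leE[OF assms(2)]) (rule that; simp)
  have "boundary (G\<lparr>carrier := H\<rparr>) E H = {}" by (auto simp: boundary_iff)
  then have "invariant_set (G\<lparr>carrier := H\<rparr>) E \<eta> H" using E by (simp add: invariant_set_def)
  then have "real (H.visits H A x) \<le> a * real (card H)" using * assms(1) x by blast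
  then have "H.visits H A x = 0" using assms(3) by linarith
  moreover have "\<one> \<in> {f\<in>H. \<phi> f x \<in> A}" using x subgroup.one_closed[OF subgroup_axioms] by simp
  ultimately show False using assms(1) by (auto simp: H.visits_def)
qed

text \<open>Take a castle \<open>(S i, V i)\<close> for \<open>H\<close> with small remainder, an approximate fundamental domain \<open>Y\<close> that is
nearly invariant at the scale of the shapes \<open>S i\<close>, and keep in \<open>W i\<close> those base points whose tile lies entirely in
\<open>Y\<close>.  Then \<open>(T <#> S i, W i)\<close> is a castle for \<open>G\<close>, since tiles inside \<open>Y\<close> are disjoint and so are the
translates of \<open>Y\<close>.  Its remainder \<open>R\<close> has small \<open>H\<close>-density.

The sets \<open>S' i\<close> of the definition are taken to be \<open>T <#> S'' i\<close> with \<open>S'' i\<close> of cardinality \<open>\<lfloor>|S i| / n\<rfloor>\<close>.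
If \<open>H\<close> is infinite, nonempty shapes have at least \<open>n\<close> elements, so a definite proportion of each tower
is selected.  Since the selection treats all translates of \<open>Y\<close> alike, every \<open>H\<close>-orbit visits the selected levels
with a frequency bounded below, and comparison for \<open>H\<close> moves \<open>R\<close> into them.  If \<open>H\<close> is finite, the
selection may be empty, but then so is \<open>R\<close>.\<close>

lemma almost_finite_G: "almost_finite G X \<phi>"
  unfolding almost_finite_def
proof (intro allI impI)
  fix n :: nat and K and \<delta> :: real
  assume "1 \<le> n \<and> finite K \<and> K \<subseteq> carrier G \<and> 0 < \<delta>"
  then have n: "n \<ge> 1" and K: "finite K" "K \<subseteq> carrier G" and \<delta>: "\<delta> > 0" by auto
  have TG: "t \<in> carrier G" if "t \<in> T" for t using that transversal(2) by auto
  have TH: "t \<otimes> h \<otimes> inv t \<in> H" if "t \<in> T" "h \<in> H" for t h using inv_op_closed2 TG that by simp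
  \<comment> \<open>The first bound is for comparison, where the selected levels have density about \<open>1 / (2 n)\<close> at
    least. The second makes small sets empty if \<open>H\<close> is finite; \<open>card H = 0\<close> if \<open>H\<close> is infinite.\<close>
  define \<epsilon> where "\<epsilon> = min (1 / (8 * real n)) (1 / (2 * (1 + real (card H))))"
  have \<epsilon>: "\<epsilon> > 0" "\<epsilon> \<le> 1 / (8 * real n)" "\<epsilon> * real (card H) < 1"
  proof -
    show "\<epsilon> > 0" using n by (auto simp: \<epsilon>_def add_pos_nonneg)
    show "\<epsilon> \<le> 1 / (8 * real n)" by (simp add: \<epsilon>_def)
    have "\<epsilon> \<le> 1 / (2 * (1 + real (card H)))" by (simp add: \<epsilon>_def)
    then have "\<epsilon> * real (card H) \<le> 1 / (2 * (1 + real (card H))) * real (card H)" by (rule mult_right_mono) simp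
    also have "\<dots> < 1" by (simp add: field_simps)
    finally show "\<epsilon> * real (card H) < 1" .
  qed
  define \<epsilon>1 where "\<epsilon>1 = \<epsilon> / (1 + 2 * real (card T))"
  have \<epsilon>1: "\<epsilon>1 > 0" "\<epsilon>1 + real (card T) * (\<epsilon>1 + \<epsilon>1) = \<epsilon>"
  proof -
    have pos: "1 + 2 * real (card T) > 0" by simp
    then show "\<epsilon>1 > 0" using \<epsilon>(1) by (simp add: \<epsilon>1_def)
    have "\<epsilon>1 + real (card T) * (\<epsilon>1 + \<epsilon>1) = \<epsilon>1 * (1 + 2 * real (card T))" by (simp add: algebra_simps)
    also have "\<dots> = \<epsilon>" using pos by (simp add: \<epsilon>1_def)
    finally show "\<epsilon>1 + real (card T) * (\<epsilon>1 + \<epsilon>1) = \<epsilon>" .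
  qed
  obtain E0 where E0: "finite E0" "E0 \<subseteq> H"
    and inv_TS: "\<And>S \<delta>. finite S \<Longrightarrow> S \<subseteq> H \<Longrightarrow> invariant_set (G\<lparr>carrier := H\<rparr>) E0 \<delta> S
      \<Longrightarrow> invariant_set G K \<delta> (T <#> S)"
    by (rule invariant_set_transversal_mult[OF K]) (rule that)
  \<comment> \<open>If \<open>H\<close> is infinite, invariance under \<open>n\<close> elements forces nonempty shapes to have at least \<open>n\<close> elements.\<close>
  obtain K0 where K0: "finite K0" "K0 \<subseteq> H" "infinite H \<Longrightarrow> card K0 = n"
  proof (cases "finite H")
    case True then show ?thesis using that[of "{}"] by simp
  next
    case False then show ?thesis using infinite_arbitrarily_large[of H n] that by blast
  qed
  obtain \<rho> :: real where \<rho>: "\<rho> > 0"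
    "\<And>t A. t \<in> T \<Longrightarrow> A \<subseteq> X \<Longrightarrow> diameter A < \<rho> \<Longrightarrow> diameter (\<phi> t ` A) < \<delta>"
    by (rule small_translates_uniformly[OF \<delta>]) (rule that)
  define E1 where "E1 = E0 \<union> insert \<one> K0"
  have E1: "finite E1" "E1 \<subseteq> carrier (G\<lparr>carrier := H\<rparr>)" "min \<delta> (1/2) > 0"
    using E0 K0 \<delta> subgroup.one_closed[OF subgroup_axioms] by (auto simp: E1_def)
  obtain I :: "nat set" and S V where
    oc: "open_castle (G\<lparr>carrier := H\<rparr>) X \<phi> I S V"
    and inv: "\<And>i. i \<in> I \<Longrightarrow> invariant_set (G\<lparr>carrier := H\<rparr>) E1 (min \<delta> (1/2)) (S i)"
    and diam: "\<And>i s. i \<in> I \<Longrightarrow> s \<in> S i \<Longrightarrow> diameter (\<phi> s ` V i) < \<rho>"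
    and dens: "H.density_le (X - (\<Union>i\<in>I. translates \<phi> (S i) (V i))) \<epsilon>1"
    by (rule H.castle_with_small_remainder[OF E1 \<rho>(1) \<epsilon>1(1)]) (rule that)
  have cas: "castle (G\<lparr>carrier := H\<rparr>) X \<phi> I S V" using oc by (simp add: open_castle_def)
  have I: "finite I" and S: "\<And>i. i \<in> I \<Longrightarrow> finite (S i)" "\<And>i. i \<in> I \<Longrightarrow> S i \<subseteq> H"
    and V: "\<And>i. i \<in> I \<Longrightarrow> openin (top_of_set X) (V i)" "\<And>i. i \<in> I \<Longrightarrow> V i \<subseteq> X"
    using oc by (auto simp: open_castle_def castle_def tower_def)
  have SG: "s \<in> carrier G" if "i \<in> I" "s \<in> S i" for i s using S(2)[OF that(1)] that(2) H_subset by auto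
  have SH: "s \<in> H" if "i \<in> I" "s \<in> S i" for i s using S(2)[OF that(1)] that(2) by auto
  \<comment> \<open>Invariance of \<open>Y\<close> under \<open>E\<close> at one point of a tile implies that the whole tile lies in \<open>Y\<close>.\<close>
  define E where "E = (\<Union>i\<in>I. (\<lambda>(s, s'). s' \<otimes> inv s) ` (S i \<times> S i))"
  have E: "finite E" "E \<subseteq> H"
    using I S SH subgroup.m_closed[OF subgroup_axioms] subgroup.m_inv_closed[OF subgroup_axioms]
    by (auto simp: E_def)
  obtain Y Bad where Y: "openin (top_of_set X) Y"
    "\<And>t t'. t \<in> T \<Longrightarrow> t' \<in> T \<Longrightarrow> t \<noteq> t' \<Longrightarrow> \<phi> t ` Y \<inter> \<phi> t' ` Y = {}"
    and Bad: "H.density_le Bad \<epsilon>1" "Bad \<subseteq> X"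
    and Y_cover: "\<And>x. x \<in> X \<Longrightarrow> x \<notin> Bad \<Longrightarrow> \<exists>t\<in>T. x \<in> \<phi> t ` Y"
    and Y_inv: "\<And>x e. x \<in> Y \<Longrightarrow> x \<notin> Bad \<Longrightarrow> e \<in> E \<Longrightarrow> \<phi> e x \<in> Y"
    by (rule approximate_fundamental_domain[OF E \<epsilon>1(1)]) (rule that)
  have YX: "Y \<subseteq> X" using openin_imp_subset[OF Y(1)] .
  define W where "W i = {v\<in>V i. \<forall>s\<in>S i. \<phi> s v \<in> Y}" for i
  have WV: "W i \<subseteq> V i" for i by (auto simp: W_def)
  have WX: "v \<in> X" if "i \<in> I" "v \<in> W i" for i v using V(2)[OF that(1)] that(2) by (auto simp: W_def)
  have W_open: "openin (top_of_set X) (W i)" if i: "i \<in> I" for i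
  proof -
    have "W i = \<Inter> (insert (V i) ((\<lambda>s. X \<inter> \<phi> s -` Y) ` S i))"
      using V(2)[OF i] by (auto simp: W_def)
    moreover have "openin (top_of_set X) \<dots>"
    proof (rule openin_Inter)
      fix A assume "A \<in> insert (V i) ((\<lambda>s. X \<inter> \<phi> s -` Y) ` S i)"
      then consider "A = V i" | s where "s \<in> S i" "A = X \<inter> \<phi> s -` Y" by blast
      then show "openin (top_of_set X) A"
      proof cases
        case 2
        have "s \<in> carrier G" using SG i 2 by blast
        then show ?thesis unfolding 2(2)
          by (intro continuous_openin_preimage[OF continuous_act _ Y(1)]) auto
      qed (use V i in simp)
    qed (use S i in auto)
    ultimately show ?thesis by simp
  qed
  have unique: "i = i' \<and> t = t' \<and> s = s' \<and> v = v'"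
    if "i \<in> I" "i' \<in> I" "t \<in> T" "t' \<in> T" "s \<in> S i" "s' \<in> S i'" "v \<in> W i" "v' \<in> W i'"
      "\<phi> (t \<otimes> s) v = \<phi> (t' \<otimes> s') v'" for i i' t t' s s' v v'
  proof -
    have X: "v \<in> X" "v' \<in> X" using WX that by blast+
    have c: "t \<in> carrier G" "t' \<in> carrier G" "s \<in> carrier G" "s' \<in> carrier G" using that TG SG by blast+
    have y: "\<phi> s v \<in> Y" "\<phi> s' v' \<in> Y" using that by (auto simp: W_def)
    have eq: "\<phi> t (\<phi> s v) = \<phi> t' (\<phi> s' v')" using that(9) X c by (simp add: act_mult)
    have "\<phi> t (\<phi> s v) \<in> \<phi> t ` Y" using y(1) by (rule imageI)
    moreover have "\<phi> t (\<phi> s v) \<in> \<phi> t' ` Y" unfolding eq using y(2) by (rule imageI)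
    ultimately have tt: "t = t'" using Y(2)[OF that(3,4)] by blast
    then have ss: "\<phi> s v = \<phi> s' v'"
      using eq inj_onD[OF inj_prop[OF c(2)], of "\<phi> s v" "\<phi> s' v'"] X c by simp
    have V': "v \<in> V i" "v' \<in> V i'" using that WV by blast+
    have "i = i' \<and> s = s'"
      by (rule H.castle_levels_unique[OF cas that(1,2,5,6) imageI[OF V'(1)]])
        (unfold ss, rule imageI[OF V'(2)])
    then show ?thesis using tt ss inj_onD[OF inj_prop[OF c(3)], of v v'] X by simp
  qed
  have TS_mem: "g \<in> T <#> A \<longleftrightarrow> (\<exists>t\<in>T. \<exists>s\<in>A. g = t \<otimes> s)" for g A by (auto simp: set_mult_def)
  have TSG: "T <#> A \<subseteq> carrier G" if "i \<in> I" "A \<subseteq> S i" for i A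
    using SG[OF that(1)] that(2) TG by (auto simp: set_mult_def)
  have castle_G: "open_castle G X \<phi> I (\<lambda>i. T <#> S i) W"
    unfolding open_castle_def castle_def
  proof (intro conjI ballI)
    show "tower G X \<phi> (T <#> S i) (W i)" if i: "i \<in> I" for i
      unfolding tower_def
    proof (intro conjI)
      show "finite (T <#> S i)" using S(1)[OF i] transversal(1) by (simp add: set_mult_def)
      show "T <#> S i \<subseteq> carrier G" using TSG[OF i] by simp
      show "W i \<subseteq> X" using WX[OF i] by blast
      show "disjoint_family_on (\<lambda>s. \<phi> s ` W i) (T <#> S i)"
        unfolding disjoint_family_on_def
      proof (intro ballI impI, rule ccontr)
        fix g g' assume g: "g \<in> T <#> S i" "g' \<in> T <#> S i" "g \<noteq> g'" "\<phi> g ` W i \<inter> \<phi> g' ` W i \<noteq> {}"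
        then obtain t s t' s' v v' where e: "t \<in> T" "s \<in> S i" "g = t \<otimes> s" "t' \<in> T" "s' \<in> S i" "g' = t' \<otimes> s'"
          "v \<in> W i" "v' \<in> W i" "\<phi> g v = \<phi> g' v'" unfolding TS_mem by blast
        then have "t = t' \<and> s = s'" using unique[OF i i, of t t' s s' v v'] by blast
        then show False using e g(3) by blast
      qed
    qed
    show "disjoint_family_on (\<lambda>i. translates \<phi> (T <#> S i) (W i)) I"
      unfolding disjoint_family_on_def
    proof (intro ballI impI, rule ccontr)
      fix i i' assume i: "i \<in> I" "i' \<in> I" "i \<noteq> i'"
        "translates \<phi> (T <#> S i) (W i) \<inter> translates \<phi> (T <#> S i') (W i') \<noteq> {}"
      then obtain g g' v v' where "g \<in> T <#> S i" "g' \<in> T <#> S i'" "v \<in> W i" "v' \<in> W i'" "\<phi> g v = \<phi> g' v'"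
        unfolding translates_def by blast
      moreover then obtain t s t' s' where "t \<in> T" "s \<in> S i" "g = t \<otimes> s" "t' \<in> T" "s' \<in> S i'" "g' = t' \<otimes> s'"
        unfolding TS_mem by blast
      ultimately show False using unique[OF i(1,2), of t t' s s' v v'] i(3) by blast
    qed
  qed (use I W_open in auto)
  define R where "R = X - (\<Union>i\<in>I. translates \<phi> (T <#> S i) (W i))"
  have R_dens: "H.density_le R \<epsilon>"
  proof -
    let ?R1 = "X - (\<Union>i\<in>I. translates \<phi> (S i) (V i))"
    have "H.density_le (\<phi> t ` (?R1 \<union> Bad)) (\<epsilon>1 + \<epsilon>1)" if "t \<in> T" for t
      using Bad(2) by (intro density_le_translate[OF TG[OF that] _ H.density_le_Un[OF dens Bad(1)]]) auto
    then have "H.density_le (\<Union>t\<in>T. \<phi> t ` (?R1 \<union> Bad)) (\<Sum>t\<in>T. \<epsilon>1 + \<epsilon>1)"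
      by (intro H.density_le_UN transversal(1))
    then have "H.density_le (Bad \<union> (\<Union>t\<in>T. \<phi> t ` (?R1 \<union> Bad))) (\<epsilon>1 + (\<Sum>t\<in>T. \<epsilon>1 + \<epsilon>1))"
      by (rule H.density_le_Un[OF Bad(1)])
    moreover have "R \<inter> X \<subseteq> Bad \<union> (\<Union>t\<in>T. \<phi> t ` (?R1 \<union> Bad))"
    proof
      fix x assume x: "x \<in> R \<inter> X"
      show "x \<in> Bad \<union> (\<Union>t\<in>T. \<phi> t ` (?R1 \<union> Bad))"
      proof (cases "x \<in> Bad")
        case False
        then obtain t y where t: "t \<in> T" "y \<in> Y" "x = \<phi> t y" using Y_cover x by blast
        have "y \<in> ?R1 \<union> Bad"
        proof (rule ccontr)
          assume n: "y \<notin> ?R1 \<union> Bad"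
          then obtain i s v where s: "i \<in> I" "s \<in> S i" "v \<in> V i" "y = \<phi> s v"
            using t(2) YX unfolding translates_def by blast
          have vX: "v \<in> X" using V(2) s by blast
          have "\<phi> s' v \<in> Y" if s': "s' \<in> S i" for s'
          proof -
            have c: "s \<in> carrier G" "s' \<in> carrier G" using SG s(1,2) s' by blast+
            have "s' \<otimes> inv s \<in> E" using s(1,2) s' unfolding E_def by force
            then have "\<phi> (s' \<otimes> inv s) y \<in> Y" using Y_inv t(2) n by blast
            then show ?thesis using c vX s(4) by (simp add: act_mult)
          qed
          then have "v \<in> W i" using s(3) by (simp add: W_def)
          moreover have "x = \<phi> (t \<otimes> s) v" using t s TG SG vX by (simp add: act_mult)
          moreover have "t \<otimes> s \<in> T <#> S i" using TS_mem t(1) s(2) by blast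
          ultimately have "x \<in> translates \<phi> (T <#> S i) (W i)" unfolding translates_def by blast
          then show False using x s(1) by (auto simp: R_def)
        qed
        then show ?thesis using t by blast
      qed simp
    qed
    ultimately show ?thesis by (rule H.density_le_mono) (use \<epsilon>1(2) in simp)
  qed
  have "\<exists>S''. S'' \<subseteq> S i \<and> card S'' = card (S i) div n" for i
    using obtain_subset_with_card_n[of "card (S i) div n" "S i"] by (metis div_le_dividend)
  then obtain S'' where S'': "\<And>i. S'' i \<subseteq> S i" "\<And>i. card (S'' i) = card (S i) div n" by metis
  define B where "B = (\<Union>i\<in>I. translates \<phi> (T <#> S'' i) (W i))"
  have "openin (top_of_set X) (translates \<phi> (T <#> S'' i) (W i))" if "i \<in> I" for i
    by (rule openin_translates[OF TSG[OF that S''(1)] W_open[OF that]])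
  then have B_open: "openin (top_of_set X) B" unfolding B_def by (intro openin_Union) auto
  have sub: "subequivalent G X \<phi> R B"
  proof (cases "finite H")
    case True
    have "R = {}" by (rule finite_subgroup_small_density_empty[OF True R_dens \<epsilon>(3)]) (auto simp: R_def)
    then show ?thesis unfolding subequivalent_def by (auto intro!: exI[of _ 0] simp: disjoint_family_on_def)
  next
    case False
    have Kn: "card K0 = n" using K0 False by simp
    have frac: "real (card (S i - S'' i)) \<le> (1 - 1 / (2 * real n)) * real (card (S i))" if i: "i \<in> I" for i
    proof (cases "S i = {}")
      case Sne: False
      let ?esc = "{f\<in>S i. \<exists>e\<in>E1. e \<otimes>\<^bsub>G\<lparr>carrier := H\<rparr>\<^esub> f \<notin> S i}"
      have "real (card ?esc) \<le> min \<delta> (1/2) * real (card (S i))"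
        by (rule H.card_escaping_le[OF E1(1) S(1)[OF i] E1(2) _ _ inv[OF i]])
          (use S(2)[OF i] in \<open>auto simp: E1_def\<close>)
      also have "\<dots> \<le> 1 / 2 * real (card (S i))" by (rule mult_right_mono) auto
      also have "\<dots> < real (card (S i))" using Sne S(1)[OF i] by (simp add: card_gt_0_iff)
      finally have "?esc \<noteq> S i" by auto
      then obtain f where f: "f \<in> S i" "\<forall>e\<in>E1. e \<otimes> f \<in> S i" by auto
      have "card K0 \<le> card (S i)"
      proof (rule card_inj_on_le[where f = "\<lambda>e. e \<otimes> f"])
        show "inj_on (\<lambda>e. e \<otimes> f) K0"
          using SG[OF i f(1)] K0(2) H_subset by (intro inj_onI) (auto simp: subset_iff)
        show "(\<lambda>e. e \<otimes> f) ` K0 \<subseteq> S i" using f by (auto simp: E1_def)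
      qed (use S i in auto)
      then have q: "card (S i) div n \<ge> 1" using Kn n by (simp add: div_greater_zero_iff Suc_le_eq)
      have "card (S i) = n * (card (S i) div n) + card (S i) mod n" by simp
      also have "\<dots> \<le> n * (card (S i) div n) + n" using n by (intro add_left_mono less_imp_le mod_less_divisor) auto
      also have "\<dots> \<le> n * (card (S i) div n) + n * (card (S i) div n)" using q by (intro add_left_mono) simp
      finally have "card (S i) \<le> 2 * n * (card (S i) div n)" by simp
      then have "real (card (S i)) \<le> real (2 * n * (card (S i) div n))" by (simp only: of_nat_le_iff)
      then have "real (card (S i)) \<le> 2 * real n * real (card (S'' i))" using S''(2)[of i] by simp
      then have half: "1 / (2 * real n) * real (card (S i)) \<le> real (card (S'' i))"
        using n by (simp add: field_simps)
      have "real (card (S i - S'' i)) = real (card (S i)) - real (card (S'' i))"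
        using S''(1)[of i] S(1)[OF i] finite_subset[OF S''(1) S(1)[OF i]]
        by (simp add: card_Diff_subset card_mono of_nat_diff)
      then show ?thesis using half by (simp add: left_diff_distrib)
    qed simp
    \<comment> \<open>As an \<open>H\<close>-castle, the castle of \<open>G\<close> consists of the towers with shapes \<open>t (S i) t\<inverse>\<close> and bases
      \<open>t (W i)\<close>. The levels that are not selected form the subtowers with shapes \<open>D2\<close>.\<close>
    define c where "c t s = t \<otimes> s \<otimes> inv t" for t s
    have c_act: "\<phi> (c t s) (\<phi> t v) = \<phi> (t \<otimes> s) v" if "t \<in> T" "s \<in> carrier G" "v \<in> X" for t s v
      using that TG[OF that(1)] by (simp add: c_def act_mult)
    have c_inj: "inj_on (c t) (S i)" if "t \<in> T" "i \<in> I" for t i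
      using TG[OF that(1)] SG[OF that(2)] by (intro inj_onI) (simp add: c_def)
    define S2 where "S2 = (\<lambda>(t, i). c t ` S i)"
    define V2 where "V2 = (\<lambda>(t, i). \<phi> t ` W i)"
    define D2 where "D2 = (\<lambda>(t, i). c t ` (S i - S'' i))"
    have castle2: "castle (G\<lparr>carrier := H\<rparr>) X \<phi> (T \<times> I) S2 V2"
      unfolding castle_def
    proof (intro conjI ballI)
      show "finite (T \<times> I)" using transversal(1) I by simp
      show "tower (G\<lparr>carrier := H\<rparr>) X \<phi> (S2 q) (V2 q)" if "q \<in> T \<times> I" for q
      proof -
        obtain t i where q: "q = (t, i)" "t \<in> T" "i \<in> I" using \<open>q \<in> T \<times> I\<close> by blast
        show ?thesis unfolding tower_def
        proof (intro conjI)
          show "finite (S2 q)" using S q by (simp add: S2_def)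
          show "S2 q \<subseteq> carrier (G\<lparr>carrier := H\<rparr>)" using TH[OF q(2)] SH[OF q(3)] by (auto simp: q(1) S2_def c_def)
          show "V2 q \<subseteq> X" using TG[OF q(2)] WX[OF q(3)] by (auto simp: q(1) V2_def)
          show "disjoint_family_on (\<lambda>s. \<phi> s ` V2 q) (S2 q)"
            unfolding disjoint_family_on_def
          proof (intro ballI impI, rule ccontr)
            fix g g' assume g: "g \<in> S2 q" "g' \<in> S2 q" "g \<noteq> g'" "\<phi> g ` V2 q \<inter> \<phi> g' ` V2 q \<noteq> {}"
            obtain s s' where s: "s \<in> S i" "g = c t s" "s' \<in> S i" "g' = c t s'"
              using g(1,2) by (auto simp: q(1) S2_def)
            obtain v v' where v: "v \<in> W i" "v' \<in> W i" "\<phi> g (\<phi> t v) = \<phi> g' (\<phi> t v')"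
              using g(4) by (auto simp: q(1) V2_def)
            have "\<phi> (t \<otimes> s) v = \<phi> (t \<otimes> s') v'"
              using v(3) c_act[OF q(2)] SG[OF q(3)] WX[OF q(3)] s v(1,2) by simp
            then have "s = s'" using unique[OF q(3,3,2,2) s(1,3) v(1,2)] by blast
            then show False using s g(3) by simp
          qed
        qed
      qed
      show "disjoint_family_on (\<lambda>q. translates \<phi> (S2 q) (V2 q)) (T \<times> I)"
        unfolding disjoint_family_on_def
      proof (intro ballI impI, rule ccontr)
        fix q q' assume q: "q \<in> T \<times> I" "q' \<in> T \<times> I" "q \<noteq> q'"
          "translates \<phi> (S2 q) (V2 q) \<inter> translates \<phi> (S2 q') (V2 q') \<noteq> {}"
        obtain t i where ti: "q = (t, i)" "t \<in> T" "i \<in> I" using q(1) by blast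
        obtain t' i' where ti': "q' = (t', i')" "t' \<in> T" "i' \<in> I" using q(2) by blast
        obtain s v s' v' where sv: "s \<in> S i" "v \<in> W i" "s' \<in> S i'" "v' \<in> W i'"
          "\<phi> (c t s) (\<phi> t v) = \<phi> (c t' s') (\<phi> t' v')"
          using q(4) unfolding ti ti' translates_def S2_def V2_def by auto
        have "\<phi> (t \<otimes> s) v = \<phi> (t' \<otimes> s') v'"
          using sv(5) c_act[OF ti(2) SG[OF ti(3) sv(1)] WX[OF ti(3) sv(2)]]
            c_act[OF ti'(2) SG[OF ti'(3) sv(3)] WX[OF ti'(3) sv(4)]] by simp
        then have "i = i' \<and> t = t'" using unique[OF ti(3) ti'(3) ti(2) ti'(2) sv(1,3,2,4)] by blast
        then show False using q(3) ti ti' by simp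
      qed
    qed
    have "H.density_le (\<Union>q\<in>T \<times> I. translates \<phi> (D2 q) (V2 q)) ((1 - 1 / (2 * real n)) + 1 / (8 * real n))"
    proof (rule H.density_le_subtowers[OF castle2])
      fix q assume "q \<in> T \<times> I"
      then obtain t i where q: "q = (t, i)" "t \<in> T" "i \<in> I" by blast
      show "D2 q \<subseteq> S2 q" by (auto simp: q(1) D2_def S2_def)
      have "card (D2 q) = card (S i - S'' i)"
        unfolding q(1) D2_def using c_inj[OF q(2,3)] by (simp add: card_image inj_on_diff)
      moreover have "card (S2 q) = card (S i)"
        unfolding q(1) S2_def using c_inj[OF q(2,3)] by (simp add: card_image)
      ultimately show "real (card (D2 q)) \<le> (1 - 1 / (2 * real n)) * real (card (S2 q))"
        using frac[OF q(3)] by simp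
    qed (use n in \<open>auto simp: field_simps\<close>)
    then have "H.density_le (R \<union> (\<Union>q\<in>T \<times> I. translates \<phi> (D2 q) (V2 q)))
        (\<epsilon> + ((1 - 1 / (2 * real n)) + 1 / (8 * real n)))"
      by (rule H.density_le_Un[OF R_dens])
    moreover have "(X - B) \<inter> X \<subseteq> R \<union> (\<Union>q\<in>T \<times> I. translates \<phi> (D2 q) (V2 q))"
    proof
      fix x assume x: "x \<in> (X - B) \<inter> X"
      show "x \<in> R \<union> (\<Union>q\<in>T \<times> I. translates \<phi> (D2 q) (V2 q))"
      proof (cases "x \<in> R")
        case False
        then obtain i g v where g: "i \<in> I" "g \<in> T <#> S i" "v \<in> W i" "x = \<phi> g v"
          using x unfolding R_def translates_def by blast
        then obtain t s where ts: "t \<in> T" "s \<in> S i" "g = t \<otimes> s" unfolding TS_mem by blast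
        have "s \<notin> S'' i"
        proof
          assume "s \<in> S'' i"
          then have "g \<in> T <#> S'' i" using ts TS_mem by blast
          then have "x \<in> B" using g unfolding B_def translates_def by blast
          then show False using x by blast
        qed
        then have "c t s \<in> D2 (t, i)" using ts by (simp add: D2_def)
        moreover have "\<phi> t v \<in> V2 (t, i)" using g by (simp add: V2_def)
        moreover have "x = \<phi> (c t s) (\<phi> t v)"
          using c_act[OF ts(1) SG[OF g(1) ts(2)] WX[OF g(1,3)]] g ts by simp
        ultimately have "x \<in> translates \<phi> (D2 (t, i)) (V2 (t, i))" unfolding translates_def by blast
        then show ?thesis using ts(1) g(1) by blast
      qed simp
    qed
    ultimately have XB: "H.density_le (X - B) (\<epsilon> + ((1 - 1 / (2 * real n)) + 1 / (8 * real n)))"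
      by (rule H.density_le_mono) simp
    have "\<epsilon> + (\<epsilon> + ((1 - 1 / (2 * real n)) + 1 / (8 * real n))) < 1"
    proof -
      have "1 / (2 * real n) = 4 * (1 / (8 * real n))" by simp
      moreover have "1 / (8 * real n) > 0" using n by simp
      ultimately show ?thesis using \<epsilon>(2) by linarith
    qed
    then show ?thesis by (rule subequivalent_from_H[OF B_open R_dens XB])
  qed
  have inv_G: "invariant_set G K \<delta> (T <#> S i)" if i: "i \<in> I" for i
  proof (rule inv_TS[OF S[OF i]])
    show "invariant_set (G\<lparr>carrier := H\<rparr>) E0 \<delta> (S i)"
      by (rule H.invariant_set_mono[OF E1(1) S(1)[OF i] E1(2) _ _ inv[OF i]]) (auto simp: E1_def)
  qed
  have diam_G: "diameter (\<phi> g ` W i) < \<delta>" if i: "i \<in> I" and g: "g \<in> T <#> S i" for i g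
  proof -
    obtain t s where ts: "t \<in> T" "s \<in> S i" "g = t \<otimes> s" using g unfolding TS_mem by blast
    have sW: "\<phi> s ` W i \<subseteq> \<phi> s ` V i" using WV by blast
    have sX: "\<phi> s ` V i \<subseteq> X" using translate_subset[OF SG[OF i ts(2)] V(2)[OF i]] .
    have "bounded (\<phi> s ` V i)" using compact_imp_bounded[OF compact_space] sX bounded_subset by blast
    then have "diameter (\<phi> s ` W i) \<le> diameter (\<phi> s ` V i)" using diameter_subset[OF sW] by blast
    then have "diameter (\<phi> s ` W i) < \<rho>" using diam[OF i ts(2)] by linarith
    then have "diameter (\<phi> t ` \<phi> s ` W i) < \<delta>" using \<rho>(2)[OF ts(1)] sW sX by blast
    moreover have "\<phi> g ` W i = \<phi> t ` \<phi> s ` W i"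
      using act_mult[OF TG[OF ts(1)] SG[OF i ts(2)] WX[OF i]] ts(3) by (simp add: image_image)
    ultimately show ?thesis by simp
  qed
  have card_G: "T <#> S'' i \<subseteq> T <#> S i \<and> real (card (T <#> S'' i)) \<le> real (card (T <#> S i)) / real n"
    if i: "i \<in> I" for i
  proof
    show "T <#> S'' i \<subseteq> T <#> S i" using S''(1) unfolding set_mult_def by blast
    have "S'' i \<subseteq> H" using S''(1) S(2)[OF i] by blast
    then have "real (card (T <#> S'' i)) = real (card T) * real (card (S i) div n)"
      by (simp add: card_transversal_mult S''(2))
    also have "\<dots> \<le> real (card T) * (real (card (S i)) / real n)"
      by (intro mult_left_mono) (simp_all add: of_nat_div_le_of_nat)
    also have "\<dots> = real (card (T <#> S i)) / real n"
      using S(2)[OF i] by (simp add: card_transversal_mult)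
    finally show "real (card (T <#> S'' i)) \<le> real (card (T <#> S i)) / real n" .
  qed
  show "\<exists>(I::nat set) S V S'. open_castle G X \<phi> I S V \<and> (\<forall>i\<in>I. invariant_set G K \<delta> (S i)) \<and>
          (\<forall>i\<in>I. \<forall>s\<in>S i. diameter (\<phi> s ` V i) < \<delta>) \<and>
          (\<forall>i\<in>I. S' i \<subseteq> S i \<and> real (card (S' i)) \<le> real (card (S i)) / real n) \<and>
          subequivalent G X \<phi> (X - (\<Union>i\<in>I. translates \<phi> (S i) (V i)))
            (\<Union>i\<in>I. translates \<phi> (S' i) (V i))"
    by (rule exI[of _ I], rule exI[of _ "\<lambda>i. T <#> S i"], rule exI[of _ W], rule exI[of _ "\<lambda>i. T <#> S'' i"])
      (use castle_G inv_G diam_G card_G sub in \<open>simp add: R_def B_def\<close>)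
qed

end

theorem theorem3p1:
  fixes G :: "('g, 'm) monoid_scheme" and H :: "'g set"
    and X :: "'x::metric_space set" and \<phi> :: "'g \<Rightarrow> 'x \<Rightarrow> 'x"
  assumes "group G"
    and "finite_extension G H"
    and "countable H"
    and "compact X"
    and "free_continuous_action G X \<phi>"
    and "almost_finite (G\<lparr>carrier := H\<rparr>) X \<phi>"
  shows "almost_finite G X \<phi>"
proof -
  have normal: "H \<lhd> G" and fin: "finite (carrier (G Mod H))"
    using assms(2) by (simp_all add: finite_extension_def)
  interpret normal H G by (rule normal)
  have act: "group_action G X \<phi>" and cont: "\<And>g. g \<in> carrier G \<Longrightarrow> continuous_on X (\<phi> g)"
    and free: "\<And>g x. g \<in> carrier G \<Longrightarrow> x \<in> X \<Longrightarrow> \<phi> g x = x \<Longrightarrow> g = \<one>\<^bsub>G\<^esub>"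
    using assms(5) by (auto simp: free_continuous_action_def)
  interpret group_action G X \<phi> by (rule act)
  define rep where "rep C = (SOME g. g \<in> C)" for C :: "'g set"
  have rep: "rep C \<in> C" if "C \<in> rcosets\<^bsub>G\<^esub> H" for C
    unfolding rep_def using rcosets_non_empty[OF that] by (simp add: some_in_eq)
  define T where "T = rep ` (rcosets\<^bsub>G\<^esub> H)"
  have T: "finite T" using fin by (simp add: T_def FactGroup_def)
  have TG: "T \<subseteq> carrier G"
    using rep rcosets_part_G[OF subgroup_axioms] by (auto simp: T_def)
  have mem: "inv\<^bsub>G\<^esub> t \<otimes>\<^bsub>G\<^esub> g \<in> H \<longleftrightarrow> t \<in> H #>\<^bsub>G\<^esub> g"
    if "t \<in> carrier G" "g \<in> carrier G" for t g
  proof -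
    have "inv\<^bsub>G\<^esub> t \<otimes>\<^bsub>G\<^esub> g \<in> H \<longleftrightarrow> g \<in> H #>\<^bsub>G\<^esub> t"
    proof
      assume "inv\<^bsub>G\<^esub> t \<otimes>\<^bsub>G\<^esub> g \<in> H"
      moreover have "t \<otimes>\<^bsub>G\<^esub> (inv\<^bsub>G\<^esub> t \<otimes>\<^bsub>G\<^esub> g) = g" using that by (simp add: m_assoc[symmetric])
      ultimately have "g \<in> t <#\<^bsub>G\<^esub> H" unfolding l_coset_def by force
      then show "g \<in> H #>\<^bsub>G\<^esub> t" using coset_eq that by simp
    next
      assume "g \<in> H #>\<^bsub>G\<^esub> t"
      then have "g \<in> t <#\<^bsub>G\<^esub> H" using coset_eq that by simp
      then obtain h where h: "h \<in> H" "g = t \<otimes>\<^bsub>G\<^esub> h" unfolding l_coset_def by blast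
      then have "h \<in> carrier G" using subset by blast
      then have "inv\<^bsub>G\<^esub> t \<otimes>\<^bsub>G\<^esub> g = h" using that h(2) by (simp add: m_assoc[symmetric])
      then show "inv\<^bsub>G\<^esub> t \<otimes>\<^bsub>G\<^esub> g \<in> H" using h(1) by simp
    qed
    also have "\<dots> \<longleftrightarrow> t \<in> H #>\<^bsub>G\<^esub> g"
      using repr_independence[OF _ _ subgroup_axioms] rcos_self[OF _ subgroup_axioms] that by metis
    finally show ?thesis .
  qed
  have "\<exists>!t. t \<in> T \<and> inv\<^bsub>G\<^esub> t \<otimes>\<^bsub>G\<^esub> g \<in> H" if g: "g \<in> carrier G" for g
  proof -
    let ?C = "H #>\<^bsub>G\<^esub> g"
    have C: "?C \<in> rcosets\<^bsub>G\<^esub> H" using g by (auto simp: RCOSETS_def)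
    show ?thesis
    proof (rule ex1I[of _ "rep ?C"])
      show "rep ?C \<in> T \<and> inv\<^bsub>G\<^esub> rep ?C \<otimes>\<^bsub>G\<^esub> g \<in> H"
        using C rep[OF C] mem g TG by (auto simp: T_def)
      fix t assume t: "t \<in> T \<and> inv\<^bsub>G\<^esub> t \<otimes>\<^bsub>G\<^esub> g \<in> H"
      then have "t \<in> ?C" using mem g TG by blast
      obtain C' where C': "C' \<in> rcosets\<^bsub>G\<^esub> H" "t = rep C'" using t by (auto simp: T_def)
      then have "C' = ?C"
        using rep[OF C'(1)] \<open>t \<in> ?C\<close> rcos_disjoint[OF subgroup_axioms] C by (auto simp: pairwise_def disjnt_def)
      then show "t = rep ?C" using C' by simp
    qed
  qed
  then interpret finite_index_action G H X \<phi> T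
    by unfold_locales (use assms(4,6) cont free T TG in auto)
  show ?thesis by (rule almost_finite_G)
qed

end
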